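(* There is a polynomial $p$ such that the following holds. For any $n\ge1$, any non-empty $X\subseteq\{0,1\}^n$ with $P=\operatorname{conv}(X)$, and any $\varepsilon>0$, there exists a polytope $Q=\{(x,y)\in\mathbb{R}^n\times\mathbb{R}^{\operatorname{xc}(P)}\mid Bx+Cy\le d\}$ with $B\in\mathbb{Q}^{(4\operatorname{xc}(P)+2n)\times n}$, $C\in\mathbb{Q}^{(4\operatorname{xc}(P)+2n)\times\operatorname{xc}(P)}$, $d\in\mathbb{Q}^{4\operatorname{xc}(P)+2n}$ of total encoding length at most $p(n,\operatorname{xc}(P),\log(1/\varepsilon))$, such that $P\subseteq\operatorname{proj}_x(Q)\subseteq P+\varepsilon$. Furthermore, for every $c\in\mathbb{R}^n$, $\max\{c^Tx\mid x\in\operatorname{proj}_x(Q)\}-\max\{c^Tx\mid x\in P\}\le\varepsilon\|c\|_2$.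
   Context: $\operatorname{proj}_x(Q)=\{x\in\mathbb{R}^n\mid\exists y:(x,y)\in Q\}$. $P+\varepsilon=\{x+z\mid x\in P,\ \|z\|_2\le\varepsilon\}$. For a polytope $P$, an extension is a polyhedron $Q'\subseteq\mathbb{R}^m$ with a linear map $\pi$ such that $\pi(Q')=P$; an extended formulation is a description $Q'=\{z\mid C'z\le c',\ D'z=d'\}$, whose size is the number of inequalities; $\operatorname{xc}(P)$ is the minimum size of an extended formulation of $P$. *)

theory Defs
  imports "HOL-Analysis.Analysis"
begin

text \<open>Points of R^n are represented as functions nat => real that vanish outside {..<n}.\<close>

definition vec_in :: "nat \<Rightarrow> (nat \<Rightarrow> real) \<Rightarrow> bool" where
  "vec_in n x \<longleftrightarrow> (\<forall>i\<ge>n. x i = 0)"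

definition dotn :: "nat \<Rightarrow> (nat \<Rightarrow> real) \<Rightarrow> (nat \<Rightarrow> real) \<Rightarrow> real" where
  "dotn n c x = (\<Sum>i<n. c i * x i)"

definition norm2 :: "nat \<Rightarrow> (nat \<Rightarrow> real) \<Rightarrow> real" where
  "norm2 n x = sqrt (\<Sum>i<n. (x i)\<^sup>2)"

definition cube01 :: "nat \<Rightarrow> (nat \<Rightarrow> real) set" where
  "cube01 n = {x. vec_in n x \<and> (\<forall>i<n. x i = 0 \<or> x i = 1)}"

definition conv :: "(nat \<Rightarrow> real) set \<Rightarrow> (nat \<Rightarrow> real) set" where
  "conv X = {x. \<exists>S u. finite S \<and> S \<noteq> {} \<and> S \<subseteq> X \<and> (\<forall>s\<in>S. u s \<ge> (0::real)) \<and> sum u S = 1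
              \<and> x = (\<lambda>i. \<Sum>s\<in>S. u s * s i)}"

definition thicken :: "nat \<Rightarrow> (nat \<Rightarrow> real) set \<Rightarrow> real \<Rightarrow> (nat \<Rightarrow> real) set" where
  "thicken n P eps = {(\<lambda>i. x i + z i) | x z. x \<in> P \<and> vec_in n z \<and> norm2 n z \<le> eps}"

definition ext_formulation :: "nat \<Rightarrow> (nat \<Rightarrow> real) set \<Rightarrow> nat \<Rightarrow> bool" where
  "ext_formulation n P k \<longleftrightarrow>
    (\<exists>(m::nat) (l::nat) (C'::nat \<Rightarrow> nat \<Rightarrow> real) (c'::nat \<Rightarrow> real) (D'::nat \<Rightarrow> nat \<Rightarrow> real)
        (d'::nat \<Rightarrow> real) (Pm::nat \<Rightarrow> nat \<Rightarrow> real).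
       (\<lambda>z. \<lambda>i. if i < n then (\<Sum>j<m. Pm i j * z j) else 0) `
         {z. vec_in m z \<and> (\<forall>r<k. (\<Sum>j<m. C' r j * z j) \<le> c' r)
               \<and> (\<forall>r<l. (\<Sum>j<m. D' r j * z j) = d' r)} = P)"

definition xc :: "nat \<Rightarrow> (nat \<Rightarrow> real) set \<Rightarrow> nat" where
  "xc n P = (LEAST k. ext_formulation n P k)"

definition enc_int :: "int \<Rightarrow> nat" where
  "enc_int z = 1 + nat \<lceil>log 2 (real_of_int \<bar>z\<bar> + 1)\<rceil>"

definition enc_rat :: "rat \<Rightarrow> nat" where
  "enc_rat r = (case quotient_of r of (a, b) \<Rightarrow> enc_int a + enc_int b)"

definition enc_system :: "nat \<Rightarrow> nat \<Rightarrow> nat \<Rightarrow> (nat \<Rightarrow> nat \<Rightarrow> rat) \<Rightarrow> (nat \<Rightarrow> nat \<Rightarrow> rat)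
    \<Rightarrow> (nat \<Rightarrow> rat) \<Rightarrow> nat" where
  "enc_system nr n k B C d =
     (\<Sum>r<nr. (\<Sum>i<n. enc_rat (B r i)) + (\<Sum>j<k. enc_rat (C r j)) + enc_rat (d r))"

definition polyQ :: "nat \<Rightarrow> nat \<Rightarrow> nat \<Rightarrow> (nat \<Rightarrow> nat \<Rightarrow> rat) \<Rightarrow> (nat \<Rightarrow> nat \<Rightarrow> rat)
    \<Rightarrow> (nat \<Rightarrow> rat) \<Rightarrow> ((nat \<Rightarrow> real) \<times> (nat \<Rightarrow> real)) set" where
  "polyQ nr n k B C d = {(x, y). vec_in n x \<and> vec_in k y \<and>
     (\<forall>r<nr. (\<Sum>i<n. real_of_rat (B r i) * x i) + (\<Sum>j<k. real_of_rat (C r j) * y j)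
                 \<le> real_of_rat (d r))}"

definition proj_x :: "((nat \<Rightarrow> real) \<times> (nat \<Rightarrow> real)) set \<Rightarrow> (nat \<Rightarrow> real) set" where
  "proj_x Q = {x. \<exists>y. (x, y) \<in> Q}"

text \<open>A polytope is a bounded polyhedron; boundedness of Q in R^n x R^k.\<close>
definition bounded_pairs :: "((nat \<Rightarrow> real) \<times> (nat \<Rightarrow> real)) set \<Rightarrow> bool" where
  "bounded_pairs Q \<longleftrightarrow> (\<exists>M. \<forall>(x, y)\<in>Q. \<forall>i. \<bar>x i\<bar> \<le> M \<and> \<bar>y i\<bar> \<le> M)"

definition poly3 :: "(nat \<Rightarrow> nat \<Rightarrow> nat \<Rightarrow> real) \<Rightarrow> nat \<Rightarrow> real \<Rightarrow> real \<Rightarrow> real \<Rightarrow> real" where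
  "poly3 a D u v w = (\<Sum>i\<le>D. \<Sum>j\<le>D. \<Sum>k\<le>D. a i j k * u ^ i * v ^ j * w ^ k)"

end

theory Submission
  imports Defs
begin

text \<open>Let \<open>k = xc P\<close>. Adjoining the slacks of a minimal extended formulation as coordinates \<open>y\<close>
  presents \<open>P\<close> as the projection of \<open>{(x, y) \<in> A. 0 \<le> y}\<close> for an affine subspace \<open>A\<close> of
  \<open>R^(n+k)\<close>; scaling \<open>y\<close>, we may add \<open>y \<le> 1\<close>. Gaussian elimination with full pivoting gives
  \<open>n + k\<close> equations for \<open>A\<close> with entries in \<open>[-1, 1]\<close> such that violating them by \<open>t\<close> means being
  within \<open>2^((n+k)^2) * t\<close> of \<open>A\<close>. Moving such a nearby point of \<open>A\<close> towards the mean of the lifted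
  vertices, whose relevant slacks are at least \<open>2^-n\<close>, restores \<open>0 \<le> y\<close>. So the system has an error
  bound that is single exponential in a polynomial of \<open>n + k\<close>, and rounding the equations to
  polynomially many bits, each replaced by two inequalities with a matching slack, moves the
  projection by at most \<open>\<epsilon>\<close>. This makes \<open>2 * (n + k) + 2 * k\<close> inequalities.\<close>

section \<open>Linear algebra on finitely many coordinates\<close>

definition lin_set :: "(nat \<Rightarrow> real) set \<Rightarrow> bool" where
  "lin_set W \<longleftrightarrow> (\<lambda>_. 0) \<in> W \<and> (\<forall>u\<in>W. \<forall>v\<in>W. \<forall>a b. (\<lambda>i. a * u i + b * v i) \<in> W)"

definition aff_set :: "(nat \<Rightarrow> real) set \<Rightarrow> bool" where
  "aff_set A \<longleftrightarrow> (\<forall>u\<in>A. \<forall>v\<in>A. \<forall>t. (\<lambda>i. (1 - t) * u i + t * v i) \<in> A)"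

lemma lin_set_comb: "lin_set W \<Longrightarrow> u \<in> W \<Longrightarrow> v \<in> W \<Longrightarrow> (\<lambda>i. a * u i + b * v i) \<in> W"
  unfolding lin_set_def by blast

lemma aff_set_comb: "aff_set A \<Longrightarrow> u \<in> A \<Longrightarrow> v \<in> A \<Longrightarrow> (\<lambda>i. (1 - t) * u i + t * v i) \<in> A"
  unfolding aff_set_def by blast

lemma sum_mult_comb:
  fixes c u v :: "'i \<Rightarrow> real"
  shows "(\<Sum>i\<in>I. c i * (a * u i + b * v i)) = a * (\<Sum>i\<in>I. c i * u i) + b * (\<Sum>i\<in>I. c i * v i)"
  by (simp add: sum.distrib sum_distrib_left algebra_simps)

text \<open>Induction on the coordinates. If some \<open>v\<close> in \<open>W\<close> is nonzero at
  \<open>j\<close>, multiples of \<open>v\<close> clear coordinate \<open>j\<close> and the rest is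
  a problem on \<open>I\<close>; otherwise coordinate \<open>j\<close> of \<open>z\<close> must be 0
  or separates by itself.\<close>

lemma annihilator_separates:
  assumes "finite I" "lin_set W"
  shows "(\<exists>w\<in>W. \<forall>i\<in>I. w i = z i) \<or>
         (\<exists>e. (\<forall>w\<in>W. (\<Sum>i\<in>I. e i * w i) = 0) \<and> (\<Sum>i\<in>I. e i * z i) \<noteq> 0)"
  using assms
proof (induction I arbitrary: W z)
  case empty
  then show ?case unfolding lin_set_def by blast
next
  case (insert j I)
  show ?case
  proof (cases "\<exists>v\<in>W. v j \<noteq> 0")
    case True
    then obtain v where v: "v \<in> W" "v j \<noteq> 0" by blast
    define W0 where "W0 = {w\<in>W. w j = 0}"
    have W0: "lin_set W0" using insert.prems unfolding W0_def lin_set_def by auto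
    define z' where "z' = (\<lambda>i. 1 * z i + (- (z j / v j)) * v i)"
    from insert.IH[OF W0, of z'] show ?thesis
    proof (elim disjE bexE exE conjE)
      fix w assume w: "w \<in> W0" "\<forall>i\<in>I. w i = z' i"
      have "(\<lambda>i. 1 * w i + (z j / v j) * v i) \<in> W"
        using lin_set_comb[OF insert.prems] w v unfolding W0_def by blast
      moreover have "\<forall>i\<in>insert j I. 1 * w i + (z j / v j) * v i = z i"
        using w v by (auto simp: z'_def W0_def)
      ultimately show ?thesis by (intro disjI1 bexI)
    next
      fix e assume e: "\<forall>w\<in>W0. (\<Sum>i\<in>I. e i * w i) = 0" "(\<Sum>i\<in>I. e i * z' i) \<noteq> 0"
      \<comment> \<open>\<open>e'\<close> extends \<open>e\<close> to \<open>j\<close> so as to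
        annihilate \<open>v\<close>. Hence its value at any \<open>u\<close> is that of
        \<open>e\<close> at \<open>u\<close> minus the multiple of \<open>v\<close> that cancels
        coordinate \<open>j\<close>.\<close>
      define e' where "e' = e(j := - (\<Sum>i\<in>I. e i * v i) / v j)"
      have s: "(\<Sum>i\<in>insert j I. e' i * u i) = (\<Sum>i\<in>I. e i * (1 * u i + (- (u j / v j)) * v i))" for u
      proof -
        have "(\<Sum>i\<in>I. e' i * u i) = (\<Sum>i\<in>I. e i * u i)"
          using insert.hyps by (intro sum.cong) (auto simp: e'_def)
        then show ?thesis
          unfolding sum_mult_comb using insert.hyps v by (simp add: e'_def field_simps)
      qed
      have "(\<Sum>i\<in>insert j I. e' i * u i) = 0" if "u \<in> W" for u
      proof -
        have "(\<lambda>i. 1 * u i + (- (u j / v j)) * v i) \<in> W0"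
          using lin_set_comb[OF insert.prems that v(1), of 1 "- (u j / v j)"] v unfolding W0_def by simp
        then show ?thesis using e(1) s[of u] by simp
      qed
      moreover have "(\<Sum>i\<in>insert j I. e' i * z i) \<noteq> 0"
        using e(2) s[of z] unfolding z'_def by simp
      ultimately show ?thesis by blast
    qed
  next
    case False
    show ?thesis
    proof (cases "z j = 0")
      case True
      from insert.IH[OF insert.prems, of z] show ?thesis
      proof (elim disjE bexE exE conjE)
        fix w assume "w \<in> W" "\<forall>i\<in>I. w i = z i"
        then show ?thesis using False True by (intro disjI1 bexI[of _ w]) auto
      next
        fix e assume "\<forall>w\<in>W. (\<Sum>i\<in>I. e i * w i) = 0" "(\<Sum>i\<in>I. e i * z i) \<noteq> 0"
        then show ?thesis using False True insert.hyps by (intro disjI2 exI[of _ e]) auto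
      qed
    next
      \<comment> \<open>Every member of \<open>W\<close> vanishes at \<open>j\<close> while
        \<open>z\<close> does not, so the coordinate functional at \<open>j\<close>
        separates.\<close>
      case nz: False
      have d: "(\<Sum>i\<in>insert j I. (if i = j then 1 else 0) * u i) = u j" for u :: "nat \<Rightarrow> real"
        using insert.hyps by (simp add: if_distrib [of "\<lambda>x. x * _"] sum.delta cong: if_cong)
      show ?thesis using False nz d by (intro disjI2 exI[of _ "\<lambda>i. if i = j then 1 else 0"]) auto
    qed
  qed
qed

text \<open>Gaussian elimination with full pivoting: every pivot row has entries at most 1 in absolute
  value and pivot entry 1, so each elimination step inflates the error bound only by a factor
  depending on the dimension.\<close>

lemma well_conditioned_equations:
  fixes I :: "nat set"
  assumes "finite I"
  shows "\<exists>g. (\<forall>r\<in>I. \<forall>i\<in>I. \<bar>g r i\<bar> \<le> 1) \<and>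
    (\<forall>w. (\<forall>e\<in>E. (\<Sum>i\<in>I. e i * w i) = 0) \<longrightarrow> (\<forall>r\<in>I. (\<Sum>i\<in>I. g r i * w i) = 0)) \<and>
    (\<forall>z t. 0 \<le> t \<longrightarrow> (\<forall>r\<in>I. \<bar>\<Sum>i\<in>I. g r i * z i\<bar> \<le> t) \<longrightarrow>
      (\<exists>w. (\<forall>e\<in>E. (\<Sum>i\<in>I. e i * w i) = 0) \<and>
           (\<forall>i\<in>I. \<bar>z i - w i\<bar> \<le> 2 ^ (card I)\<^sup>2 * (t::real))))"
  using assms
proof (induction "card I" arbitrary: I E)
  case 0
  then show ?case by auto
next
  case (Suc m)
  show ?case
  proof (cases "\<forall>e\<in>E. \<forall>i\<in>I. e i = 0")
    \<comment> \<open>No equation constrains the coordinates in \<open>I\<close>: zero rows serve,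
      and every \<open>z\<close> is its own solution.\<close>
    case True
    then have "\<exists>w. (\<forall>e\<in>E. (\<Sum>i\<in>I. e i * w i) = 0) \<and> (\<forall>i\<in>I. \<bar>z i - w i\<bar> \<le> 2 ^ (card I)\<^sup>2 * t)"
      if "0 \<le> t" for z t using that by (intro exI[of _ z]) auto
    then show ?thesis
      by (intro exI[of _ "\<lambda>_ _. 0"]) auto
  next
    case False
    then obtain e i0 where e: "e \<in> E" "i0 \<in> I" "e i0 \<noteq> 0" by blast
    have "Max ((\<lambda>i. \<bar>e i\<bar>) ` I) \<in> (\<lambda>i. \<bar>e i\<bar>) ` I"
      using e Suc.prems by (intro Max_in) auto
    then obtain j where j: "j \<in> I" "\<bar>e j\<bar> = Max ((\<lambda>i. \<bar>e i\<bar>) ` I)" by auto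
    have jmax: "\<bar>e i\<bar> \<le> \<bar>e j\<bar>" if "i \<in> I" for i
      using j that Suc.prems by simp
    have ej: "e j \<noteq> 0" using jmax[OF e(2)] e(3) by auto
    define h where "h = (\<lambda>i. e i / e j)"
    have h1: "\<bar>h i\<bar> \<le> 1" if "i \<in> I" for i
      using jmax[OF that] ej by (simp add: h_def abs_divide)
    have hj: "h j = 1" using ej by (simp add: h_def)
    define J where "J = I - {j}"
    have J: "finite J" "j \<notin> J" "I = insert j J" "m = card J"
      using j Suc.prems Suc.hyps(2) by (auto simp: J_def)
    have cI: "card I = Suc m" using Suc.hyps(2) by simp
    \<comment> \<open>Subtracting \<open>f j\<close> times \<open>h\<close> clears column
      \<open>j\<close>, because \<open>h j = 1\<close>. The new rows may have large entries, which
      does no harm: the induction hypothesis allows arbitrary equations and depends on them only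
      through their common zeros.\<close>
    define E' where "E' = (\<lambda>f i. 1 * f i + (- f j) * h i) ` E"
    obtain g' where g': "\<forall>r\<in>J. \<forall>i\<in>J. \<bar>g' r i\<bar> \<le> 1"
      "\<forall>w. (\<forall>e\<in>E'. (\<Sum>i\<in>J. e i * w i) = 0) \<longrightarrow> (\<forall>r\<in>J. (\<Sum>i\<in>J. g' r i * w i) = 0)"
      "\<forall>z t. 0 \<le> t \<longrightarrow> (\<forall>r\<in>J. \<bar>\<Sum>i\<in>J. g' r i * z i\<bar> \<le> t) \<longrightarrow>
        (\<exists>w. (\<forall>e\<in>E'. (\<Sum>i\<in>J. e i * w i) = 0) \<and> (\<forall>i\<in>J. \<bar>z i - w i\<bar> \<le> 2 ^ (card J)\<^sup>2 * (t::real)))"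
      using Suc.hyps(1)[OF J(4) J(1), of E'] by blast
    \<comment> \<open>Row \<open>j\<close> is the normalised pivot row; the other rows come from the
      smaller system, with 0 in column \<open>j\<close>.\<close>
    define g where "g = (\<lambda>r i. if r = j then h i else if i = j then 0 else g' r i)"
    have split: "(\<Sum>i\<in>I. f i * w i) = f j * (\<Sum>i\<in>I. h i * w i) + (\<Sum>i\<in>J. (1 * f i + (- f j) * h i) * w i)"
      for f w :: "nat \<Rightarrow> real"
    proof -
      have "(\<Sum>i\<in>J. (1 * f i + (- f j) * h i) * w i) = (\<Sum>i\<in>J. f i * w i) - f j * (\<Sum>i\<in>J. h i * w i)"
        by (simp add: sum_distrib_left sum_subtractf algebra_simps)
      then show ?thesis using J hj by (simp add: algebra_simps)
    qed
    have gj: "(\<Sum>i\<in>I. g j i * w i) = (\<Sum>i\<in>I. h i * w i)" for w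
      by (simp add: g_def)
    have gr: "(\<Sum>i\<in>I. g r i * w i) = (\<Sum>i\<in>J. g' r i * w i)" if "r \<in> J" for r w
    proof -
      have "r \<noteq> j" using that J by auto
      moreover have "(\<Sum>i\<in>J. g r i * w i) = (\<Sum>i\<in>J. g' r i * w i)"
        using J \<open>r \<noteq> j\<close> by (intro sum.cong) (auto simp: g_def)
      ultimately show ?thesis using J by (simp add: g_def)
    qed
    show ?thesis
    proof (intro exI[of _ g] conjI allI impI)
      show "\<forall>r\<in>I. \<forall>i\<in>I. \<bar>g r i\<bar> \<le> 1"
        using g'(1) h1 J by (auto simp: g_def)
    next
      fix w assume w: "\<forall>e\<in>E. (\<Sum>i\<in>I. e i * w i) = 0"
      have "(\<Sum>i\<in>I. h i * w i) = (\<Sum>i\<in>I. e i * w i) / e j"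
        by (simp add: h_def sum_divide_distrib)
      then have hw: "(\<Sum>i\<in>I. h i * w i) = 0" using w e by simp
      have "\<forall>e\<in>E'. (\<Sum>i\<in>J. e i * w i) = 0"
      proof
        fix e assume "e \<in> E'"
        then obtain f where f: "f \<in> E" "e = (\<lambda>i. 1 * f i + (- f j) * h i)" unfolding E'_def by blast
        show "(\<Sum>i\<in>J. e i * w i) = 0" using split[of f w] hw w f(1) unfolding f(2) by simp
      qed
      with g'(2) have "\<forall>r\<in>J. (\<Sum>i\<in>J. g' r i * w i) = 0" by blast
      then show "\<forall>r\<in>I. (\<Sum>i\<in>I. g r i * w i) = 0"
        using hw gj gr J(3) by (metis insertE)
    next
      fix z and t :: real
      assume t: "0 \<le> t" and gz: "\<forall>r\<in>I. \<bar>\<Sum>i\<in>I. g r i * z i\<bar> \<le> t"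
      have "\<forall>r\<in>J. \<bar>\<Sum>i\<in>J. g' r i * z i\<bar> \<le> t" using gz gr J(3) by (metis insertI2)
      with g'(3) t obtain w' where w': "\<forall>e\<in>E'. (\<Sum>i\<in>J. e i * w' i) = 0"
        "\<forall>i\<in>J. \<bar>z i - w' i\<bar> \<le> 2 ^ (card J)\<^sup>2 * t" by blast
      \<comment> \<open>Back substitution: the pivot equation determines coordinate
        \<open>j\<close>.\<close>
      define w where "w = w'(j := - (\<Sum>i\<in>J. h i * w' i))"
      have wJ: "(\<Sum>i\<in>J. f i * w i) = (\<Sum>i\<in>J. f i * w' i)" for f
        using J by (intro sum.cong) (auto simp: w_def)
      have hw: "(\<Sum>i\<in>I. h i * w i) = 0" using J hj wJ[of h] by (simp add: w_def)
      have "\<forall>f\<in>E. (\<Sum>i\<in>I. f i * w i) = 0"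
      proof
        fix f assume "f \<in> E"
        then have "(\<lambda>i. 1 * f i + (- f j) * h i) \<in> E'" unfolding E'_def by blast
        then show "(\<Sum>i\<in>I. f i * w i) = 0" using split[of f w] hw w'(1) wJ by simp
      qed
      moreover have "\<bar>z i - w i\<bar> \<le> 2 ^ (card I)\<^sup>2 * t" if "i \<in> I" for i
      proof (cases "i = j")
        case False
        then have "\<bar>z i - w i\<bar> \<le> 2 ^ (card J)\<^sup>2 * t" using w'(2) that by (auto simp: w_def J_def)
        also have "\<dots> \<le> 2 ^ (card I)\<^sup>2 * t"
          using t cI J(4) by (intro mult_right_mono power_increasing) (auto simp: power2_eq_square)
        finally show ?thesis .
      next
        case True
        have "\<bar>\<Sum>i\<in>J. h i * (z i - w' i)\<bar> \<le> (\<Sum>i\<in>J. \<bar>h i * (z i - w' i)\<bar>)" by (rule sum_abs)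
        also have "\<dots> \<le> (\<Sum>i\<in>J. 2 ^ (card J)\<^sup>2 * t)"
        proof (rule sum_mono)
          fix i assume i: "i \<in> J"
          have "\<bar>h i\<bar> * \<bar>z i - w' i\<bar> \<le> 1 * (2 ^ (card J)\<^sup>2 * t)"
            using h1[of i] w'(2) i J(3) by (intro mult_mono) auto
          then show "\<bar>h i * (z i - w' i)\<bar> \<le> 2 ^ (card J)\<^sup>2 * t" by (simp add: abs_mult)
        qed
        finally have s: "\<bar>\<Sum>i\<in>J. h i * (z i - w' i)\<bar> \<le> real m * (2 ^ m\<^sup>2 * t)" using J(4) by simp
        \<comment> \<open>The error at \<open>j\<close> is the residual of the pivot row, at most
          \<open>t\<close>, minus \<open>m\<close> earlier errors weighted by entries of absolute
          value at most 1.\<close>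
        have "z j - w j = (\<Sum>i\<in>I. h i * z i) - (\<Sum>i\<in>J. h i * (z i - w' i))"
          using J hj by (simp add: w_def algebra_simps sum_subtractf)
        then have "\<bar>z j - w j\<bar> \<le> t + real m * (2 ^ m\<^sup>2 * t)"
          using gz[rule_format, OF j(1)] s unfolding gj by linarith
        also have "\<dots> \<le> 2 ^ m\<^sup>2 * t + real m * (2 ^ m\<^sup>2 * t)"
          using t mult_right_mono[of 1 "2 ^ m\<^sup>2" t] by simp
        also have "\<dots> = real (Suc m) * (2 ^ m\<^sup>2 * t)" by (simp add: algebra_simps)
        \<comment> \<open>The exponent may grow by \<open>(m + 1)^2 - m^2 = 2 * m + 1\<close>, which
          amply covers the factor \<open>m + 1\<close>.\<close>
        also have "\<dots> \<le> 2 ^ (2 * m + 1) * (2 ^ m\<^sup>2 * t)"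
        proof (rule mult_right_mono)
          have "real (Suc m) \<le> 2 ^ m" using less_exp[of m] by (metis Suc_leI numeral_power_le_of_nat_cancel_iff of_nat_le_iff of_nat_numeral of_nat_power)
          also have "\<dots> \<le> 2 ^ (2 * m + 1)" by (intro power_increasing) auto
          finally show "real (Suc m) \<le> 2 ^ (2 * m + 1)" .
        qed (use t in auto)
        also have "\<dots> = 2 ^ (card I)\<^sup>2 * t"
          unfolding cI by (simp add: power_add[symmetric] power2_eq_square algebra_simps)
        finally show ?thesis using True by simp
      qed
      ultimately show "\<exists>w. (\<forall>e\<in>E. (\<Sum>i\<in>I. e i * w i) = 0) \<and> (\<forall>i\<in>I. \<bar>z i - w i\<bar> \<le> 2 ^ (card I)\<^sup>2 * t)"
        by blast
    qed
  qed
qed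

text \<open>The elimination is applied to all functionals on the first \<open>D\<close> coordinates
  that annihilate \<open>W\<close>. A common zero of these need not lie in \<open>W\<close>, whose
  members are infinite sequences, but by \<open>annihilator_separates\<close> it agrees with a
  member of \<open>W\<close> on those coordinates.\<close>

lemma subspace_equations:
  assumes "lin_set W"
  obtains g where "\<And>r i. r < D \<Longrightarrow> i < D \<Longrightarrow> \<bar>g r i\<bar> \<le> 1"
    "\<And>w r. w \<in> W \<Longrightarrow> r < D \<Longrightarrow> (\<Sum>i<D. g r i * w i) = 0"
    "\<And>z t. 0 \<le> t \<Longrightarrow> (\<And>r. r < D \<Longrightarrow> \<bar>\<Sum>i<D. g r i * z i\<bar> \<le> t) \<Longrightarrow>
       \<exists>w\<in>W. \<forall>i<D. \<bar>z i - w i\<bar> \<le> 2 ^ D\<^sup>2 * (t::real)"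
proof -
  define E where "E = {e. \<forall>w\<in>W. (\<Sum>i<D. e i * w i) = 0}"
  obtain g where g: "\<forall>r\<in>{..<D}. \<forall>i\<in>{..<D}. \<bar>g r i\<bar> \<le> 1"
    "\<forall>w. (\<forall>e\<in>E. (\<Sum>i<D. e i * w i) = 0) \<longrightarrow> (\<forall>r\<in>{..<D}. (\<Sum>i<D. g r i * w i) = 0)"
    "\<forall>z t. 0 \<le> t \<longrightarrow> (\<forall>r\<in>{..<D}. \<bar>\<Sum>i<D. g r i * z i\<bar> \<le> t) \<longrightarrow>
      (\<exists>w. (\<forall>e\<in>E. (\<Sum>i<D. e i * w i) = 0) \<and> (\<forall>i\<in>{..<D}. \<bar>z i - w i\<bar> \<le> 2 ^ (card {..<D})\<^sup>2 * (t::real)))"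
    using well_conditioned_equations[of "{..<D}" E] by blast
  show thesis
  proof (rule that[of g])
    show "\<bar>g r i\<bar> \<le> 1" if "r < D" "i < D" for r i using g(1) that by auto
    show "(\<Sum>i<D. g r i * w i) = 0" if "w \<in> W" "r < D" for w r
      using g(2) that unfolding E_def by auto
    fix z and t :: real
    assume "0 \<le> t" "\<And>r. r < D \<Longrightarrow> \<bar>\<Sum>i<D. g r i * z i\<bar> \<le> t"
    then obtain w where w: "\<forall>e\<in>E. (\<Sum>i<D. e i * w i) = 0" "\<forall>i<D. \<bar>z i - w i\<bar> \<le> 2 ^ D\<^sup>2 * t"
      using g(3)[rule_format, of t z] by auto
    have "\<exists>w'\<in>W. \<forall>i\<in>{..<D}. w' i = w i"
      using annihilator_separates[of "{..<D}", OF _ assms, of w] w(1) unfolding E_def by blast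
    then obtain w' where "w' \<in> W" "\<forall>i\<in>{..<D}. w' i = w i" ..
    then show "\<exists>w\<in>W. \<forall>i<D. \<bar>z i - w i\<bar> \<le> 2 ^ D\<^sup>2 * t"
      using w(2) by (intro bexI[of _ w']) auto
  qed
qed

text \<open>\<open>aff_set\<close> provides only lines through two points, so the points are added
  one at a time, the mean of the previous \<open>card S\<close> points having weight
  \<open>card S / (card S + 1)\<close>.\<close>

lemma aff_set_mean:
  assumes "aff_set A" "finite S" "S \<noteq> {}" "\<And>s. s \<in> S \<Longrightarrow> f s \<in> A"
  shows "(\<lambda>i. (\<Sum>s\<in>S. f s i) / card S) \<in> A"
  using assms(2,3,4)
proof (induction S rule: finite_ne_induct)
  case (singleton x)
  then show ?case by simp
next
  case (insert s S)
  let ?c = "real (card S)"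
  have c: "?c > 0" using insert.hyps by (simp add: card_gt_0_iff)
  have "(\<lambda>i. (1 - ?c / (?c + 1)) * f s i + ?c / (?c + 1) * ((\<Sum>s\<in>S. f s i) / card S)) \<in> A"
    using insert by (intro aff_set_comb[OF assms(1)]) auto
  moreover have "(1 - ?c / (?c + 1)) * f s i + ?c / (?c + 1) * ((\<Sum>s\<in>S. f s i) / card S)
      = (\<Sum>s\<in>insert s S. f s i) / card (insert s S)" for i
  proof -
    have "1 - ?c / (?c + 1) = 1 / (?c + 1)" using c by (simp add: field_simps)
    then show ?thesis using insert.hyps c by (simp add: add_divide_distrib add.commute)
  qed
  ultimately show ?case by simp
qed

text \<open>Scaling a direction is moving along a line through \<open>a\<close>, and a sum of two
  directions is the midpoint of their doubles.\<close>

lemma aff_set_directions: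
  assumes A: "aff_set A" and a: "a \<in> A"
  shows "lin_set {w. (\<lambda>i. a i + w i) \<in> A}"
  unfolding lin_set_def
proof (intro conjI ballI allI)
  show "(\<lambda>_. 0) \<in> {w. (\<lambda>i. a i + w i) \<in> A}" using a by simp
  fix u v :: "nat \<Rightarrow> real" and s t :: real
  assume uv: "u \<in> {w. (\<lambda>i. a i + w i) \<in> A}" "v \<in> {w. (\<lambda>i. a i + w i) \<in> A}"
  have scale: "(\<lambda>i. a i + t * w i) \<in> A" if "(\<lambda>i. a i + w i) \<in> A" for w t
    using aff_set_comb[OF A a that, of t] by (simp add: algebra_simps)
  have "(\<lambda>i. (1 - 1/2) * (a i + (2 * s) * u i) + 1/2 * (a i + (2 * t) * v i)) \<in> A"
    using uv by (intro aff_set_comb[OF A] scale) auto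
  moreover have "(1 - 1/2) * (a i + (2 * s) * u i) + 1/2 * (a i + (2 * t) * v i)
      = a i + (s * u i + t * v i)" for i by (simp add: field_simps)
  ultimately show "(\<lambda>i. s * u i + t * v i) \<in> {w. (\<lambda>i. a i + w i) \<in> A}" by simp
qed

section \<open>An error bound for extended formulations\<close>

lemma subset_conv: "X \<subseteq> conv X"
proof
  fix x assume "x \<in> X"
  then show "x \<in> conv X"
    unfolding conv_def by (intro CollectI exI[of _ "{x}"] exI[of _ "\<lambda>_. 1"]) auto
qed

text \<open>The least number \<open>xc\<close> is meaningful only if some extended formulation
  exists. The standard simplex with one coordinate per point of \<open>X\<close> maps onto
  \<open>conv X\<close>.\<close>

lemma ext_formulation_conv:
  assumes "finite X" "X \<subseteq> Collect (vec_in n)"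
  shows "\<exists>k. ext_formulation n (conv X) k"
proof -
  obtain f where f: "bij_betw f {..<card X} X"
    using ex_bij_betw_nat_finite[OF assms(1)] by (metis atLeast0LessThan)
  define N where "N = card X"
  note f = f[folded N_def]
  have "(\<lambda>z i. if i < n then (\<Sum>j<N. f j i * z j) else 0) `
     {z. vec_in N z \<and> (\<forall>r<N. (\<Sum>j<N. (if j = r then -1 else 0) * z j) \<le> (\<lambda>_. 0) r)
               \<and> (\<forall>r<(1::nat). (\<Sum>j<N. 1 * z j) = 1)} = conv X" (is "?F ` ?S = _")
  proof
    have S: "?S = {z. vec_in N z \<and> (\<forall>r<N. 0 \<le> z r) \<and> (\<Sum>j<N. z j) = 1}"
      by (auto simp: if_distrib [of "\<lambda>x. x * _"] sum.delta cong: if_cong)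
    have fX: "f j \<in> X" if "j < N" for j using f that by (auto simp: bij_betw_def)
    have f0: "f j i = 0" if "j < N" "\<not> i < n" for i j
      using fX[OF that(1)] assms(2) that(2) unfolding vec_in_def by auto
    show "?F ` ?S \<subseteq> conv X" unfolding S
    proof (rule image_subsetI)
      fix z assume z: "z \<in> {z. vec_in N z \<and> (\<forall>r<N. 0 \<le> z r) \<and> (\<Sum>j<N. z j) = 1}"
      define u where "u = (\<lambda>x. z (inv_into {..<N} f x))"
      have uf: "u (f j) = z j" if "j < N" for j
        using f that unfolding u_def bij_betw_def by (simp add: inv_into_f_f)
      have re: "(\<Sum>x\<in>X. h x) = (\<Sum>j<N. h (f j))" for h :: "_ \<Rightarrow> real"
        by (rule sum.reindex_bij_betw[OF f, symmetric])
      show "?F z \<in> conv X" unfolding conv_def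
      proof (intro CollectI exI[of _ X] exI[of _ u] conjI)
        show "sum u X = 1" using z by (simp add: re uf)
        then show "X \<noteq> {}" by auto
        show "\<forall>s\<in>X. 0 \<le> u s"
        proof
          fix s assume "s \<in> X"
          then obtain j where "j < N" "s = f j" using f by (auto simp: bij_betw_def)
          then show "0 \<le> u s" using z uf by simp
        qed
        show "?F z = (\<lambda>i. \<Sum>s\<in>X. u s * s i)"
          unfolding re using f0 by (auto simp: fun_eq_iff uf mult.commute)
      qed (use assms in auto)
    qed
    show "conv X \<subseteq> ?F ` ?S" unfolding S
    proof
      fix x assume "x \<in> conv X"
      then obtain T u where T: "finite T" "T \<subseteq> X" "\<forall>s\<in>T. 0 \<le> (u s :: real)" "sum u T = 1"
        "x = (\<lambda>i. \<Sum>s\<in>T. u s * s i)" unfolding conv_def by blast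
      define z where "z = (\<lambda>j. if j < N \<and> f j \<in> T then u (f j) else 0)"
      have re: "(\<Sum>s\<in>T. u s * h s) = (\<Sum>j<N. z j * h (f j))" for h
      proof -
        have "(\<Sum>s\<in>T. u s * h s) = (\<Sum>s\<in>X. (if s \<in> T then u s * h s else 0))"
          using T(2) assms(1) by (simp add: sum.inter_restrict[symmetric] Int_absorb1)
        also have "\<dots> = (\<Sum>j<N. (if f j \<in> T then u (f j) * h (f j) else 0))"
          by (rule sum.reindex_bij_betw[OF f, symmetric])
        also have "\<dots> = (\<Sum>j<N. z j * h (f j))" unfolding z_def by (intro sum.cong) auto
        finally show ?thesis .
      qed
      have "x = ?F z" unfolding T(5) re using f0 by (auto simp: fun_eq_iff mult.commute)
      moreover have "z \<in> {z. vec_in N z \<and> (\<forall>r<N. 0 \<le> z r) \<and> (\<Sum>j<N. z j) = 1}"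
        using re[of "\<lambda>_. 1"] T(3,4) by (auto simp: z_def vec_in_def)
      ultimately show "x \<in> ?F ` {z. vec_in N z \<and> (\<forall>r<N. 0 \<le> z r) \<and> (\<Sum>j<N. z j) = 1}" by blast
    qed
  qed
  then show ?thesis unfolding ext_formulation_def
    by (intro exI[of _ N] exI[of _ "1::nat"] exI[of _ "\<lambda>r j. if j = r then -1 else 0"]
        exI[of _ "\<lambda>_. 0"] exI[of _ "\<lambda>_ _. 1"] exI[of _ "\<lambda>_. 1"] exI[of _ "\<lambda>i j. f j i"])
qed

text \<open>The extra coordinates are the slacks of the inequalities of the extended formulation, rescaled
  so that their maximum over the chosen lifts of \<open>X\<close> is 1; slacks that vanish on all lifts
  are forced to be 0.\<close>

lemma normalised_lift:
  assumes ext: "ext_formulation n (conv X) k" and X: "finite X" "X \<noteq> {}"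
  obtains A Z where "aff_set A" "\<And>x. x \<in> X \<Longrightarrow> Z x \<in> A"
    "\<And>x i. x \<in> X \<Longrightarrow> i < n \<Longrightarrow> Z x i = x i"
    "\<And>x j. x \<in> X \<Longrightarrow> j < k \<Longrightarrow> 0 \<le> Z x (n + j) \<and> Z x (n + j) \<le> 1"
    "\<And>j. j < k \<Longrightarrow> (\<forall>a\<in>A. a (n + j) = 0) \<or> (\<exists>x\<in>X. Z x (n + j) = 1)"
    "\<And>a. a \<in> A \<Longrightarrow> \<forall>j<k. 0 \<le> a (n + j) \<Longrightarrow> (\<lambda>i. if i < n then a i else 0) \<in> conv X"
proof -
  from ext obtain m l :: nat and C c D d Pm where
    P: "(\<lambda>z. \<lambda>i. if i < n then (\<Sum>j<m. Pm i j * z j) else 0) `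
         {z. vec_in m z \<and> (\<forall>r<k. (\<Sum>j<m. C r j * z j) \<le> c r)
               \<and> (\<forall>r<l. (\<Sum>j<m. D r j * z j) = d r)} = conv X"
    unfolding ext_formulation_def by blast
  define sl where "sl = (\<lambda>r z. c r - (\<Sum>j<m. C r j * z j))"
  have "\<forall>x\<in>X. \<exists>z. vec_in m z \<and> (\<forall>r<k. 0 \<le> sl r z) \<and> (\<forall>r<l. (\<Sum>j<m. D r j * z j) = d r) \<and>
      x = (\<lambda>i. if i < n then (\<Sum>j<m. Pm i j * z j) else 0)"
    using subset_conv[of X] unfolding P[symmetric] sl_def by auto
  from bchoice[OF this] obtain \<zeta> where
    "\<forall>x\<in>X. vec_in m (\<zeta> x) \<and> (\<forall>r<k. 0 \<le> sl r (\<zeta> x)) \<and> (\<forall>r<l. (\<Sum>j<m. D r j * \<zeta> x j) = d r) \<and>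
      x = (\<lambda>i. if i < n then (\<Sum>j<m. Pm i j * \<zeta> x j) else 0)" ..
  then have \<zeta>: "\<And>x. x \<in> X \<Longrightarrow> vec_in m (\<zeta> x)"
    "\<And>x r. x \<in> X \<Longrightarrow> r < k \<Longrightarrow> 0 \<le> sl r (\<zeta> x)"
    "\<And>x r. x \<in> X \<Longrightarrow> r < l \<Longrightarrow> (\<Sum>j<m. D r j * \<zeta> x j) = d r"
    "\<And>x. x \<in> X \<Longrightarrow> x = (\<lambda>i. if i < n then (\<Sum>j<m. Pm i j * \<zeta> x j) else 0)"
    by blast+
  define s where "s = (\<lambda>r. Max ((\<lambda>x. sl r (\<zeta> x)) ` X))"
  have s_ge: "sl r (\<zeta> x) \<le> s r" if "x \<in> X" for x r
    using that X unfolding s_def by simp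
  have s_at: "\<exists>x\<in>X. sl r (\<zeta> x) = s r" for r
    using Max_in[of "(\<lambda>x. sl r (\<zeta> x)) ` X"] X unfolding s_def by fastforce
  have s0: "0 \<le> s r" if "r < k" for r using s_at[of r] \<zeta>(2) that by force
  \<comment> \<open>A slack whose maximum is 0 is left unscaled, which avoids a division by
    zero.\<close>
  define sc where "sc = (\<lambda>r. if s r = 0 then 1 else s r)"
  have sc0: "0 < sc r" if "r < k" for r using s0[OF that] unfolding sc_def by auto
  \<comment> \<open>Dropping the inequalities makes \<open>S\<close> affine; they return as
    nonnegativity of the slack coordinates of \<open>F\<close>.\<close>
  define S where "S = {z. vec_in m z \<and> (\<forall>r<l. (\<Sum>j<m. D r j * z j) = d r) \<and> (\<forall>r<k. s r = 0 \<longrightarrow> sl r z = 0)}"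
  define F where "F = (\<lambda>z i. if i < n then (\<Sum>j<m. Pm i j * z j) else sl (i - n) z / sc (i - n))"
  have slc: "sl r (\<lambda>i. (1 - t) * u i + t * v i) = (1 - t) * sl r u + t * sl r v" for r t u v
    unfolding sl_def sum_mult_comb by (simp add: algebra_simps)
  show thesis
  proof (rule that[of "F ` S" "\<lambda>x. F (\<zeta> x)"])
    show "aff_set (F ` S)"
      unfolding aff_set_def
    proof (intro ballI allI, elim imageE, hypsubst)
      fix u v t assume uv: "u \<in> S" "v \<in> S"
      have "(\<lambda>i. (1 - t) * F u i + t * F v i) = F (\<lambda>i. (1 - t) * u i + t * v i)"
        unfolding F_def slc sum_mult_comb by (auto simp: fun_eq_iff add_divide_distrib)
      moreover have "(\<lambda>i. (1 - t) * u i + t * v i) \<in> S"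
        using uv unfolding S_def mem_Collect_eq slc sum_mult_comb
        by (auto simp: vec_in_def algebra_simps)
      ultimately show "(\<lambda>i. (1 - t) * F u i + t * F v i) \<in> F ` S" by blast
    qed
    show "F (\<zeta> x) \<in> F ` S" if "x \<in> X" for x
    proof (rule imageI)
      \<comment> \<open>A slack lying between 0 and \<open>s r = 0\<close> vanishes, so the lifts
        satisfy the added equations.\<close>
      have "sl r (\<zeta> x) = 0" if "r < k" "s r = 0" for r
        using s_ge[OF \<open>x \<in> X\<close>, of r] \<zeta>(2)[OF \<open>x \<in> X\<close> that(1)] that by simp
      then show "\<zeta> x \<in> S" using \<zeta>(1,3) that unfolding S_def by auto
    qed
    show "F (\<zeta> x) i = x i" if "x \<in> X" "i < n" for x i
      using \<zeta>(4)[OF that(1)] that(2) unfolding F_def by (metis (no_types, lifting))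
    show "0 \<le> F (\<zeta> x) (n + j) \<and> F (\<zeta> x) (n + j) \<le> 1" if "x \<in> X" "j < k" for x j
      using \<zeta>(2)[OF that] s_ge[OF that(1), of j] sc0[OF that(2)]
      unfolding F_def by (auto simp: sc_def)
    show "(\<forall>a\<in>F ` S. a (n + j) = 0) \<or> (\<exists>x\<in>X. F (\<zeta> x) (n + j) = 1)" if "j < k" for j
    proof (cases "s j = 0")
      case True
      then show ?thesis using that unfolding F_def S_def by auto
    next
      case False
      obtain x where "x \<in> X" "sl j (\<zeta> x) = s j" using s_at[of j] ..
      with False have "F (\<zeta> x) (n + j) = 1" unfolding F_def sc_def by simp
      with \<open>x \<in> X\<close> show ?thesis by blast
    qed
    show "(\<lambda>i. if i < n then a i else 0) \<in> conv X"
      if "a \<in> F ` S" and pos: "\<forall>j<k. 0 \<le> a (n + j)" for a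
    proof -
      from that obtain z where z: "z \<in> S" "a = F z" by blast
      have "0 \<le> sl r z" if "r < k" for r
      proof -
        have "0 \<le> sl r z / sc r" using pos that unfolding z F_def by force
        then show ?thesis using sc0[OF that] by (simp add: zero_le_divide_iff)
      qed
      then have "z \<in> {z. vec_in m z \<and> (\<forall>r<k. (\<Sum>j<m. C r j * z j) \<le> c r)
               \<and> (\<forall>r<l. (\<Sum>j<m. D r j * z j) = d r)}"
        using z(1) unfolding S_def sl_def by auto
      moreover have "(\<lambda>i. if i < n then a i else 0) = (\<lambda>i. if i < n then (\<Sum>j<m. Pm i j * z j) else 0)"
        unfolding z F_def by auto
      ultimately show ?thesis unfolding P[symmetric] by blast
    qed
  qed
qed

section \<open>Points of the 0/1 cube and the error bound for their hulls\<close>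

lemma cube01_subset_image: "cube01 n \<subseteq> (\<lambda>S i. if i \<in> S then 1 else 0) ` Pow {..<n}"
proof
  fix x assume x: "x \<in> cube01 n"
  have "x i = (if i \<in> {i. i < n \<and> x i = 1} then 1 else 0)" for i
    using x unfolding cube01_def vec_in_def by (cases "i < n") auto
  then show "x \<in> (\<lambda>S i. if i \<in> S then 1 else 0) ` Pow {..<n}"
    by (intro image_eqI[of _ _ "{i. i < n \<and> x i = 1}"]) auto
qed

lemma finite_cube01: "finite (cube01 n)"
  by (rule finite_subset[OF cube01_subset_image]) simp

lemma card_cube01:
  assumes "X \<subseteq> cube01 n"
  shows "card X \<le> 2 ^ n"
proof -
  have "card X \<le> card ((\<lambda>S i. if i \<in> S then 1 else (0::real)) ` Pow {..<n})"
    using assms cube01_subset_image by (intro card_mono) auto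
  also have "\<dots> \<le> card (Pow {..<n})" by (intro card_image_le) auto
  finally show ?thesis by (simp add: card_Pow)
qed

lemma conv_cube01:
  assumes "X \<subseteq> cube01 n" "x \<in> conv X"
  shows "0 \<le> x i" "x i \<le> 1" "vec_in n x"
proof -
  from assms(2) obtain S u where S: "finite S" "S \<subseteq> X" "\<forall>s\<in>S. 0 \<le> (u s :: real)" "sum u S = 1"
    "x = (\<lambda>i. \<Sum>s\<in>S. u s * s i)" unfolding conv_def by blast
  have c: "0 \<le> s i \<and> s i \<le> 1" if "s \<in> S" for s i
  proof -
    have "s \<in> cube01 n" using that S(2) assms(1) by blast
    then show ?thesis unfolding cube01_def vec_in_def by (cases "i < n") auto
  qed
  show "0 \<le> x i" using c S(3) unfolding S(5) by (auto intro!: sum_nonneg mult_nonneg_nonneg)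
  have "x i \<le> (\<Sum>s\<in>S. u s)" using c S(3) unfolding S(5) by (intro sum_mono mult_left_le) auto
  then show "x i \<le> 1" using S(4) by simp
  show "vec_in n x" using S(2) assms(1) unfolding S(5) vec_in_def cube01_def
    by (auto intro!: sum.neutral)
qed

text \<open>The lower bound \<open>1 / card X\<close> on the nonzero extra coordinates of the mean of the lifts allows
  a slightly negative lift to be repaired by moving it towards that mean.\<close>

lemma extended_error_bound:
  fixes n k :: nat
  defines "D \<equiv> n + k"
  assumes ext: "ext_formulation n (conv X) k" and X: "X \<noteq> {}" "X \<subseteq> cube01 n"
  obtains g b Z where
    "\<And>r i. r < D \<Longrightarrow> i < D \<Longrightarrow> \<bar>g r i\<bar> \<le> 1"
    "\<And>x i. x \<in> X \<Longrightarrow> i < n \<Longrightarrow> Z x i = x i"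
    "\<And>x j. x \<in> X \<Longrightarrow> j < k \<Longrightarrow> 0 \<le> Z x (n + j) \<and> Z x (n + j) \<le> 1"
    "\<And>x r. x \<in> X \<Longrightarrow> r < D \<Longrightarrow> (\<Sum>i<D. g r i * Z x i) = b r"
    "\<And>z t. 0 \<le> t \<Longrightarrow> \<forall>j<k. 0 \<le> z (n + j) \<Longrightarrow> \<forall>r<D. \<bar>(\<Sum>i<D. g r i * z i) - b r\<bar> \<le> t \<Longrightarrow>
       \<exists>p\<in>conv X. \<forall>i<n. \<bar>z i - p i\<bar> \<le> 2 ^ (n + D\<^sup>2 + 1) * (t::real)"
proof -
  have finX: "finite X" using X(2) finite_cube01 finite_subset by blast
  obtain A Z where A: "aff_set A" and ZA: "\<And>x. x \<in> X \<Longrightarrow> Z x \<in> A"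
    and Zx: "\<And>x i. x \<in> X \<Longrightarrow> i < n \<Longrightarrow> Z x i = x i"
    and Zy: "\<And>x j. x \<in> X \<Longrightarrow> j < k \<Longrightarrow> 0 \<le> Z x (n + j) \<and> Z x (n + j) \<le> 1"
    and Zd: "\<And>j. j < k \<Longrightarrow> (\<forall>a\<in>A. a (n + j) = 0) \<or> (\<exists>x\<in>X. Z x (n + j) = 1)"
    and Ap: "\<And>a. a \<in> A \<Longrightarrow> \<forall>j<k. 0 \<le> a (n + j) \<Longrightarrow> (\<lambda>i. if i < n then a i else 0) \<in> conv X"
    proof (rule normalised_lift[OF ext finX X(1)], goal_cases)
    case (1 A Z)
    show ?case by (rule that) (fact 1)+
  qed
  define N where "N = real (card X)"
  have N1: "1 \<le> N" using finX X(1) unfolding N_def by (simp add: card_gt_0_iff Suc_leI)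
  have N2: "N \<le> 2 ^ n" using card_cube01[OF X(2)] unfolding N_def
    by (metis of_nat_le_iff of_nat_numeral of_nat_power)
  define a0 where "a0 = (\<lambda>i. (\<Sum>x\<in>X. Z x i) / N)"
  have a0A: "a0 \<in> A" unfolding a0_def N_def using aff_set_mean[OF A finX X(1), of Z] ZA by simp
  have a0y: "1 / N \<le> a0 (n + j)" if "j < k" "x \<in> X" "Z x (n + j) = 1" for j x
  proof -
    have "Z x (n + j) \<le> (\<Sum>x\<in>X. Z x (n + j))"
      using Zy that finX by (intro member_le_sum) auto
    then show ?thesis using N1 that unfolding a0_def by (simp add: divide_right_mono)
  qed
  have a0y0: "0 \<le> a0 (n + j)" if "j < k" for j
    using Zy that N1 unfolding a0_def by (auto intro!: divide_nonneg_nonneg sum_nonneg)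
  have a0c: "(\<lambda>i. if i < n then a0 i else 0) \<in> conv X" using Ap[OF a0A] a0y0 by blast
  have a0x: "0 \<le> a0 i \<and> a0 i \<le> 1" if "i < n" for i
    using conv_cube01(1,2)[OF X(2) a0c, of i] that by simp
  define W where "W = {w. (\<lambda>i. a0 i + w i) \<in> A}"
  have W: "lin_set W" unfolding W_def by (rule aff_set_directions[OF A a0A])
  obtain g where g1: "\<And>r i. r < D \<Longrightarrow> i < D \<Longrightarrow> \<bar>g r i\<bar> \<le> 1"
    and gW: "\<And>w r. w \<in> W \<Longrightarrow> r < D \<Longrightarrow> (\<Sum>i<D. g r i * w i) = 0"
    and gz: "\<And>z t. 0 \<le> t \<Longrightarrow> (\<And>r. r < D \<Longrightarrow> \<bar>\<Sum>i<D. g r i * z i\<bar> \<le> t) \<Longrightarrow>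
       \<exists>w\<in>W. \<forall>i<D. \<bar>z i - w i\<bar> \<le> 2 ^ D\<^sup>2 * (t::real)"
    proof (rule subspace_equations[OF W, of D], goal_cases)
    case (1 g)
    show ?case by (rule that) (fact 1)+
  qed
  \<comment> \<open>Each row annihilates the directions \<open>W\<close> and is therefore constant
    on \<open>A\<close>; \<open>b\<close> records its value at \<open>a0\<close>.\<close>
  define b where "b = (\<lambda>r. \<Sum>i<D. g r i * a0 i)"
  show thesis
  proof (rule that[of g Z b])
    show "(\<Sum>i<D. g r i * Z x i) = b r" if "x \<in> X" "r < D" for x r
    proof -
      have "(\<lambda>i. Z x i - a0 i) \<in> W" using ZA that unfolding W_def by simp
      from gW[OF this that(2)] show ?thesis unfolding b_def by (simp add: algebra_simps sum_subtractf)
    qed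
    fix z and t :: real
    assume t: "0 \<le> t" and z0: "\<forall>j<k. 0 \<le> z (n + j)"
      and zb: "\<forall>r<D. \<bar>(\<Sum>i<D. g r i * z i) - b r\<bar> \<le> t"
    have "\<exists>w\<in>W. \<forall>i<D. \<bar>(z i - a0 i) - w i\<bar> \<le> 2 ^ D\<^sup>2 * t"
      using zb unfolding b_def by (intro gz[OF t]) (simp add: algebra_simps sum_subtractf)
    then obtain w where w: "w \<in> W" "\<forall>i<D. \<bar>(z i - a0 i) - w i\<bar> \<le> 2 ^ D\<^sup>2 * t" by blast
    define \<eta> where "\<eta> = 2 ^ D\<^sup>2 * t"
    have \<eta>: "0 \<le> \<eta>" using t unfolding \<eta>_def by simp
    define a where "a = (\<lambda>i. a0 i + w i)"
    have aA: "a \<in> A" using w(1) unfolding W_def a_def by simp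
    have za: "\<bar>z i - a i\<bar> \<le> \<eta>" if "i < D" for i using w(2) that unfolding a_def \<eta>_def by (simp add: algebra_simps)
    \<comment> \<open>Slack coordinates of \<open>a\<close> are at least \<open>-\<eta>\<close>, and
      those of \<open>a0\<close> are at least \<open>1 / N\<close> unless they vanish on all of
      \<open>A\<close>. Weighting \<open>a0\<close> by \<open>N * \<eta>\<close> against weight 1
      for \<open>a\<close> cancels the deficit.\<close>
    define \<mu> where "\<mu> = N * \<eta>"
    have \<mu>: "0 \<le> \<mu>" "\<eta> \<le> \<mu>" using \<eta> N1 mult_right_mono[of 1 N \<eta>] unfolding \<mu>_def by auto
    define q where "q = (\<lambda>i. (1 - \<mu> / (1 + \<mu>)) * a i + \<mu> / (1 + \<mu>) * a0 i)"
    have qA: "q \<in> A" unfolding q_def by (rule aff_set_comb[OF A aA a0A])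
    have q: "q i = (a i + \<mu> * a0 i) / (1 + \<mu>)" for i
    proof -
    have "1 - \<mu> / (1 + \<mu>) = 1 / (1 + \<mu>)" using \<mu>(1) by (simp add: field_simps)
    then show ?thesis unfolding q_def by (simp add: add_divide_distrib)
  qed
    have "0 \<le> q (n + j)" if j: "j < k" for j
      using Zd[OF j]
    proof (elim disjE bexE)
      assume "\<forall>a\<in>A. a (n + j) = 0"
      then have "q (n + j) = 0" using qA by blast
      then show ?thesis by simp
    next
      fix x assume "x \<in> X" "Z x (n + j) = 1"
      from a0y[OF j this] have "\<mu> * (1 / N) \<le> \<mu> * a0 (n + j)" using \<mu>(1) by (intro mult_left_mono)
      then have "\<eta> \<le> \<mu> * a0 (n + j)" using N1 unfolding \<mu>_def by simp
      moreover have "- \<eta> \<le> a (n + j)" using za[of "n + j"] z0 j unfolding D_def by force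
      ultimately show ?thesis unfolding q using \<mu>(1) by simp
    qed
    then have p: "(\<lambda>i. if i < n then q i else 0) \<in> conv X" using Ap[OF qA] by blast
    show "\<exists>p\<in>conv X. \<forall>i<n. \<bar>z i - p i\<bar> \<le> 2 ^ (n + D\<^sup>2 + 1) * t"
    proof (rule bexI[OF _ p], intro allI impI)
      fix i assume i: "i < n"
      have qi: "0 \<le> q i" "q i \<le> 1" using conv_cube01(1,2)[OF X(2) p, of i] i by auto
      \<comment> \<open>The displacement is expressed through \<open>q\<close> and
        \<open>a0\<close>, whose first \<open>n\<close> coordinates lie in \<open>[0, 1]\<close>
        because both project into \<open>conv X\<close>.\<close>
      have "a i - q i = \<mu> * (q i - a0 i)" using \<mu>(1) unfolding q by (simp add: field_simps)
      also have "\<bar>\<dots>\<bar> \<le> \<mu> * 1" unfolding abs_mult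
        using \<mu>(1) qi a0x[OF i] by (intro mult_mono) auto
      finally have "\<bar>z i - q i\<bar> \<le> \<eta> + \<mu>" using za[of i] i unfolding D_def by linarith
      also have "\<dots> \<le> 2 * \<mu>" using \<mu> by simp
      also have "\<dots> \<le> 2 * (2 ^ n * \<eta>)" using N2 \<eta> unfolding \<mu>_def by (simp add: mult_right_mono)
      also have "\<dots> = 2 ^ (n + D\<^sup>2 + 1) * t" unfolding \<eta>_def by (simp add: power_add)
      finally show "\<bar>z i - (if i < n then q i else 0)\<bar> \<le> 2 ^ (n + D\<^sup>2 + 1) * t" using i by simp
    qed
  qed (use g1 Zx Zy in auto)
qed

text \<open>Cauchy-Schwarz bounds the gain from a displacement \<open>z\<close> by
  \<open>eps * norm2 n c\<close>. The bound \<open>M\<close> makes the supremum over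
  \<open>P\<close> a genuine one.\<close>

lemma sup_le_of_thicken:
  assumes P: "P \<noteq> {}" "\<And>x i. x \<in> P \<Longrightarrow> \<bar>x i\<bar> \<le> M" and Q: "P \<subseteq> Q" "Q \<subseteq> thicken n P eps"
  shows "(SUP x\<in>Q. dotn n c x) - (SUP x\<in>P. dotn n c x) \<le> eps * norm2 n c"
proof -
  have bdd: "bdd_above (dotn n c ` P)"
  proof (rule bdd_aboveI2)
    fix x assume x: "x \<in> P"
    have "c i * x i \<le> \<bar>c i\<bar> * M" for i
      using mult_left_mono[OF P(2)[OF x], of "\<bar>c i\<bar>" i] abs_le_D1[of "c i * x i"] by (simp add: abs_mult)
    then show "dotn n c x \<le> (\<Sum>i<n. \<bar>c i\<bar> * M)" unfolding dotn_def by (intro sum_mono)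
  qed
  have "(SUP x\<in>Q. dotn n c x) \<le> (SUP x\<in>P. dotn n c x) + eps * norm2 n c"
  proof (rule cSUP_least)
    show "Q \<noteq> {}" using P Q by auto
    fix x assume "x \<in> Q"
    then obtain p z where pz: "x = (\<lambda>i. p i + z i)" "p \<in> P" "norm2 n z \<le> eps"
      using Q(2) unfolding thicken_def by blast
    have "(\<Sum>i<n. c i * z i) \<le> (\<Sum>i<n. \<bar>c i\<bar> * \<bar>z i\<bar>)"
      by (intro sum_mono) (metis abs_ge_self abs_mult)
    also have "\<dots> \<le> L2_set c {..<n} * L2_set z {..<n}" by (rule L2_set_mult_ineq)
    also have "\<dots> = norm2 n z * norm2 n c" by (simp add: L2_set_def norm2_def)
    also have "\<dots> \<le> eps * norm2 n c" using pz(3) by (intro mult_right_mono) (auto simp: norm2_def sum_nonneg)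
    finally have "dotn n c z \<le> eps * norm2 n c" unfolding dotn_def .
    moreover have "dotn n c x = dotn n c p + dotn n c z"
      unfolding pz(1) dotn_def by (simp add: algebra_simps sum.distrib)
    moreover have "dotn n c p \<le> (SUP x\<in>P. dotn n c x)" by (rule cSUP_upper[OF pz(2) bdd])
    ultimately show "dotn n c x \<le> (SUP x\<in>P. dotn n c x) + eps * norm2 n c" by simp
  qed
  then show ?thesis by simp
qed

section \<open>Encoding lengths\<close>

lemma enc_int_le:
  assumes "\<bar>a\<bar> \<le> 2 ^ s"
  shows "enc_int a \<le> s + 2"
proof -
  have "real_of_int \<bar>a\<bar> \<le> real_of_int (2 ^ s)" using assms by (simp only: of_int_le_iff)
  then have "real_of_int \<bar>a\<bar> \<le> 2 ^ s" by simp
  then have "real_of_int \<bar>a\<bar> + 1 \<le> 2 ^ s + 2 ^ s" using one_le_power[of "2::real" s] by linarith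
  then have "real_of_int \<bar>a\<bar> + 1 \<le> 2 powr real (s + 1)" by (simp add: powr_realpow powr_add)
  then have "log 2 (real_of_int \<bar>a\<bar> + 1) \<le> real (s + 1)"
    by (subst log_le_iff) auto
  then have "\<lceil>log 2 (real_of_int \<bar>a\<bar> + 1)\<rceil> \<le> int (s + 1)" by (simp add: ceiling_le_iff)
  then show ?thesis unfolding enc_int_def by linarith
qed

text \<open>\<open>quotient_of\<close> gives lowest terms, and cancelling only shrinks: the reduced
  denominator divides \<open>2 ^ p\<close>, and the reduced numerator does not exceed
  \<open>a\<close> in absolute value.\<close>

lemma enc_rat_dyadic_le:
  assumes "\<bar>a\<bar> \<le> 2 ^ s"
  shows "enc_rat (of_int a / 2 ^ p) \<le> s + p + 4"
proof -
  obtain c b where q: "quotient_of (of_int a / 2 ^ p) = (c, b)" by fastforce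
  have b: "b > 0" and cop: "coprime c b"
    using quotient_of_denom_pos[OF q] quotient_of_coprime[OF q] by auto
  have "(of_int a / 2 ^ p :: rat) = of_int c / of_int b" by (rule quotient_of_div[OF q])
  then have "(of_int (a * b) :: rat) = of_int (c * 2 ^ p)" using b by (simp add: field_simps)
  then have eq: "a * b = c * 2 ^ p" by (simp only: of_int_eq_iff)
  then have "b dvd c * 2 ^ p" by (metis dvd_triv_right)
  then have "b dvd 2 ^ p" using cop by (simp add: coprime_commute coprime_dvd_mult_right_iff)
  then have b2: "b \<le> 2 ^ p" by (intro zdvd_imp_le) auto
  have "\<bar>c\<bar> * 2 ^ p = \<bar>a\<bar> * b" using arg_cong[OF eq, of abs] b by (simp add: abs_mult)
  also have "\<dots> \<le> \<bar>a\<bar> * 2 ^ p" using b2 by (intro mult_left_mono) auto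
  finally have "\<bar>c\<bar> \<le> \<bar>a\<bar>" by simp
  then have "enc_int c \<le> s + 2" using assms by (intro enc_int_le) linarith
  moreover have "enc_int b \<le> p + 2" using b b2 by (intro enc_int_le) linarith
  ultimately show ?thesis unfolding enc_rat_def q by simp
qed

section \<open>Rounding\<close>

text \<open>Rows of the rounded system, up to the common denominator \<open>2 ^ p\<close>: two opposite inequalities
  with slack \<open>T\<close> per equation, then \<open>0 \<le> y\<close>, then \<open>y \<le> 1\<close>.\<close>

definition relaxed_lhs :: "nat \<Rightarrow> nat \<Rightarrow> nat \<Rightarrow> (nat \<Rightarrow> nat \<Rightarrow> int) \<Rightarrow> nat \<Rightarrow> nat \<Rightarrow> int" where
  "relaxed_lhs n k p G r i =
     (if r < n + k then G r i
      else if r < 2 * (n + k) then - G (r - (n + k)) i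
      else if r < 2 * (n + k) + k then (if i = n + (r - 2 * (n + k)) then - (2 ^ p) else 0)
      else (if i = n + (r - 2 * (n + k) - k) then 2 ^ p else 0))"

definition relaxed_rhs :: "nat \<Rightarrow> nat \<Rightarrow> nat \<Rightarrow> (nat \<Rightarrow> int) \<Rightarrow> int \<Rightarrow> nat \<Rightarrow> int" where
  "relaxed_rhs n k p H T r =
     (if r < n + k then H r + T
      else if r < 2 * (n + k) then - H (r - (n + k)) + T
      else if r < 2 * (n + k) + k then 0
      else 2 ^ p)"

lemma sum_lessThan_add: "(\<Sum>i<n + k. f i) = (\<Sum>i<n. f i) + (\<Sum>j<k. f (n + j :: nat) :: real)"
  by (induction k) (auto simp: algebra_simps)

text \<open>The common denominator cancels from each row, and opposite rows combine into one
  absolute value. This is the form in which the rounded system is used.\<close>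

lemma mem_relaxed_polyQ:
  fixes G :: "nat \<Rightarrow> nat \<Rightarrow> int" and x y z :: "nat \<Rightarrow> real"
  assumes z_def: "z = (\<lambda>i. if i < n then x i else y (i - n))"
  shows "(x, y) \<in> polyQ (4 * k + 2 * n) n k
      (\<lambda>r i. of_int (relaxed_lhs n k p G r i) / 2 ^ p)
      (\<lambda>r j. of_int (relaxed_lhs n k p G r (n + j)) / 2 ^ p)
      (\<lambda>r. of_int (relaxed_rhs n k p H T r) / 2 ^ p) \<longleftrightarrow>
    vec_in n x \<and> vec_in k y \<and>
    (\<forall>r<n + k. \<bar>(\<Sum>i<n + k. G r i * z i) - H r\<bar> \<le> T) \<and> (\<forall>j<k. 0 \<le> y j \<and> y j \<le> 1)"
proof -
  let ?A = "relaxed_lhs n k p G" and ?d = "relaxed_rhs n k p H T"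
  let ?row = "\<lambda>r. (\<Sum>i<n + k. real_of_int (?A r i) * z i) \<le> real_of_int (?d r)"
  have row: "(\<Sum>i<n. real_of_rat (of_int (?A r i) / 2 ^ p) * x i) +
      (\<Sum>j<k. real_of_rat (of_int (?A r (n + j)) / 2 ^ p) * y j) \<le> real_of_rat (of_int (?d r) / 2 ^ p)
    \<longleftrightarrow> ?row r" for r
  proof -
    have "(\<Sum>i<n. real_of_rat (of_int (?A r i) / 2 ^ p) * x i) +
      (\<Sum>j<k. real_of_rat (of_int (?A r (n + j)) / 2 ^ p) * y j)
      = (\<Sum>i<n + k. real_of_int (?A r i) * z i) / 2 ^ p"
      unfolding sum_lessThan_add add_divide_distrib sum_divide_distrib
      by (simp add: z_def of_rat_divide of_rat_power)
    then show ?thesis by (simp add: of_rat_divide of_rat_power divide_le_cancel)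
  qed
  have r1: "?row r \<longleftrightarrow> (\<Sum>i<n + k. G r i * z i) - H r \<le> T" if "r < n + k" for r
    using that by (simp add: relaxed_lhs_def relaxed_rhs_def algebra_simps)
  have r2: "?row (n + k + r) \<longleftrightarrow> - ((\<Sum>i<n + k. G r i * z i) - H r) \<le> T" if "r < n + k" for r
    using that by (simp add: relaxed_lhs_def relaxed_rhs_def sum_negf algebra_simps)
  have delta: "(\<Sum>i<n + k. real_of_int (if i = n + j then c else 0) * z i) = c * y j" if "j < k" for j c
  proof -
    have "(\<Sum>i<n + k. real_of_int (if i = n + j then c else 0) * z i)
        = (\<Sum>i<n + k. if i = n + j then c * z i else 0)" by (intro sum.cong) auto
    then show ?thesis using that by (simp add: z_def)
  qed
  have r3: "?row (2 * (n + k) + j) \<longleftrightarrow> 0 \<le> y j" if "j < k" for j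
  proof -
    have "?A (2 * (n + k) + j) = (\<lambda>i. if i = n + j then - (2 ^ p) else 0)" "?d (2 * (n + k) + j) = 0"
      using that by (auto simp: relaxed_lhs_def relaxed_rhs_def fun_eq_iff)
    then show ?thesis using delta[OF that, of "- (2 ^ p)"] mult_le_cancel_left_pos[of "2 ^ p" 0 "y j"] by simp
  qed
  have r4: "?row (2 * (n + k) + k + j) \<longleftrightarrow> y j \<le> 1" if "j < k" for j
  proof -
    have "?A (2 * (n + k) + k + j) = (\<lambda>i. if i = n + j then 2 ^ p else 0)"
      "?d (2 * (n + k) + k + j) = 2 ^ p"
      using that by (auto simp: relaxed_lhs_def relaxed_rhs_def fun_eq_iff)
    then show ?thesis using delta[OF that, of "2 ^ p"] by simp
  qed
  \<comment> \<open>The \<open>4 * k + 2 * n\<close> row indices split into two blocks of length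
    \<open>n + k\<close> and two of length \<open>k\<close>.\<close>
  have rows: "(\<forall>r<4 * k + 2 * n. R r) \<longleftrightarrow>
      (\<forall>r<n + k. R r \<and> R (n + k + r)) \<and> (\<forall>j<k. R (2 * (n + k) + j) \<and> R (2 * (n + k) + k + j))" for R
  proof (intro iffI conjI allI impI)
    fix r assume *: "(\<forall>r<n + k. R r \<and> R (n + k + r)) \<and>
      (\<forall>j<k. R (2 * (n + k) + j) \<and> R (2 * (n + k) + k + j))" and r: "r < 4 * k + 2 * n"
    have "r < n + k \<or> n + k \<le> r \<and> r - (n + k) < n + k
      \<or> 2 * (n + k) \<le> r \<and> r - 2 * (n + k) < k \<or> 2 * (n + k) + k \<le> r \<and> r - (2 * (n + k) + k) < k"
      using r by arith
    then show "R r" using * by (elim disjE) (metis le_add_diff_inverse)+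
  qed auto
  show ?thesis
    unfolding polyQ_def mem_Collect_eq prod.case row rows
    using r1 r2 r3 r4 by (auto simp: abs_le_iff)
qed

text \<open>Replaces \<open>eps\<close> by a power of two. For \<open>eps \<ge> 1\<close> the
  function \<open>nat\<close> cuts the exponent off at 0, and the bound is
  \<open>1 \<le> eps\<close>.\<close>

lemma two_power_dominates_inverse:
  assumes "eps > 0"
  shows "1 / 2 ^ nat \<lceil>log 2 (1 / eps)\<rceil> \<le> eps"
proof -
  have "1 / eps = 2 powr (log 2 (1 / eps))" using assms by simp
  also have "\<dots> \<le> 2 powr real (nat \<lceil>log 2 (1 / eps)\<rceil>)"
    by (intro powr_mono) (auto simp: real_nat_ceiling_ge)
  also have "\<dots> = 2 ^ nat \<lceil>log 2 (1 / eps)\<rceil>" by (simp add: powr_realpow)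
  finally show ?thesis using assms by (simp add: field_simps)
qed

text \<open>Each floor is off by at most 1: every coefficient contributes at most \<open>M\<close>,
  and the right-hand side contributes the final 1.\<close>

lemma abs_rounding_error_le:
  fixes z g :: "'i \<Rightarrow> real" and M s b :: real
  assumes "finite I" "\<And>i. i \<in> I \<Longrightarrow> \<bar>z i\<bar> \<le> M"
  shows "\<bar>((\<Sum>i\<in>I. real_of_int \<lfloor>g i * s\<rfloor> * z i) - real_of_int \<lfloor>b * s\<rfloor>) - s * ((\<Sum>i\<in>I. g i * z i) - b)\<bar>
    \<le> card I * M + 1"
proof -
  have fl: "\<bar>real_of_int \<lfloor>v\<rfloor> - v\<bar> \<le> 1" for v :: real by linarith
  have "\<bar>\<Sum>i\<in>I. (real_of_int \<lfloor>g i * s\<rfloor> - g i * s) * z i\<bar> \<le> (\<Sum>i\<in>I. \<bar>(real_of_int \<lfloor>g i * s\<rfloor> - g i * s) * z i\<bar>)"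
    by (rule sum_abs)
  also have "\<dots> \<le> (\<Sum>i\<in>I. 1 * M)"
    unfolding abs_mult using assms fl by (intro sum_mono mult_mono) auto
  finally have "\<bar>\<Sum>i\<in>I. (real_of_int \<lfloor>g i * s\<rfloor> - g i * s) * z i\<bar> \<le> card I * M" by simp
  moreover have "((\<Sum>i\<in>I. real_of_int \<lfloor>g i * s\<rfloor> * z i) - real_of_int \<lfloor>b * s\<rfloor>) - s * ((\<Sum>i\<in>I. g i * z i) - b)
    = (\<Sum>i\<in>I. (real_of_int \<lfloor>g i * s\<rfloor> - g i * s) * z i) - (real_of_int \<lfloor>b * s\<rfloor> - b * s)"
    by (simp add: sum_subtractf sum_distrib_left algebra_simps)
  ultimately show ?thesis using fl[of "b * s"] by linarith
qed

text \<open>The precision \<open>p\<close> has three parts: \<open>n + D\<^sup>2 + 3\<close> pays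
  for the factor in \<open>extended_error_bound\<close> and two further doublings,
  \<open>2 * D\<close> pays for \<open>n * (D + 1) \<le> 2 ^ D * 2 ^ D\<close>, and the last term
  brings the error below \<open>eps\<close>.\<close>

lemma rational_relaxation:
  fixes n k :: nat and eps :: real
  defines "D \<equiv> n + k"
  defines "p \<equiv> n + D\<^sup>2 + 3 + 2 * D + nat \<lceil>log 2 (1 / eps)\<rceil>"
  assumes n: "n \<ge> 1" and X: "X \<noteq> {}" "X \<subseteq> cube01 n" and eps: "eps > 0"
    and ext: "ext_formulation n (conv X) k"
  shows "\<exists>B C d. bounded_pairs (polyQ (4 * k + 2 * n) n k B C d) \<and>
    (\<forall>r<4 * k + 2 * n. (\<forall>i<n. enc_rat (B r i) \<le> D + 2 * p + 6) \<and>
       (\<forall>j<k. enc_rat (C r j) \<le> D + 2 * p + 6) \<and> enc_rat (d r) \<le> D + 2 * p + 6) \<and>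
    conv X \<subseteq> proj_x (polyQ (4 * k + 2 * n) n k B C d) \<and>
    proj_x (polyQ (4 * k + 2 * n) n k B C d) \<subseteq> thicken n (conv X) eps"
proof -
  obtain g b Z where g1: "\<And>r i. r < D \<Longrightarrow> i < D \<Longrightarrow> \<bar>g r i\<bar> \<le> 1"
    and Zx: "\<And>x i. x \<in> X \<Longrightarrow> i < n \<Longrightarrow> Z x i = x i"
    and Zy: "\<And>x j. x \<in> X \<Longrightarrow> j < k \<Longrightarrow> 0 \<le> Z x (n + j) \<and> Z x (n + j) \<le> 1"
    and Zb: "\<And>x r. x \<in> X \<Longrightarrow> r < D \<Longrightarrow> (\<Sum>i<D. g r i * Z x i) = b r"
    and bound: "\<And>z t. 0 \<le> t \<Longrightarrow> \<forall>j<k. 0 \<le> z (n + j) \<Longrightarrow> \<forall>r<D. \<bar>(\<Sum>i<D. g r i * z i) - b r\<bar> \<le> t \<Longrightarrow>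
       \<exists>p\<in>conv X. \<forall>i<n. \<bar>z i - p i\<bar> \<le> 2 ^ (n + D\<^sup>2 + 1) * (t::real)"
    unfolding D_def proof (rule extended_error_bound[OF ext X], goal_cases)
    case (1 g b Z)
    show ?case by (rule that) (fact 1[folded D_def])+
  qed
  define s where "s = (2::real) ^ p"
  have s0: "s > 0" unfolding s_def by simp
  define G where "G = (\<lambda>r i. \<lfloor>g r i * s\<rfloor>)"
  define H where "H = (\<lambda>r. \<lfloor>b r * s\<rfloor>)"
  \<comment> \<open>\<open>T\<close> is the rounding error of a scaled row at a point with entries
    in \<open>[-1, 1]\<close>: \<open>D\<close> from the coefficients and 1 from the right-hand
    side. So all lifted vertices remain feasible.\<close>
  define T where "T = int D + 1"
  have Z1: "\<bar>Z x i\<bar> \<le> 1" if "x \<in> X" "i < D" for x i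
  proof (cases "i < n")
    case True
    then have "x i = 0 \<or> x i = 1" using X(2) that(1) unfolding cube01_def by blast
    then show ?thesis using Zx[OF that(1) True] by auto
  next
    case False
    then show ?thesis using Zy[OF that(1), of "i - n"] that(2) unfolding D_def by auto
  qed
  \<comment> \<open>The right-hand side equals the row value at a lifted vertex. Its bound will
    limit the encoding length of \<open>H\<close>.\<close>
  have bD: "\<bar>b r\<bar> \<le> D" if r: "r < D" for r
  proof -
    obtain x where x: "x \<in> X" using X(1) by blast
    have "\<bar>b r\<bar> \<le> (\<Sum>i<D. \<bar>g r i * Z x i\<bar>)" unfolding Zb[OF x r, symmetric] by (rule sum_abs)
    also have "\<dots> \<le> (\<Sum>i<D. 1 * 1)"
      unfolding abs_mult using g1[OF r] Z1[OF x] by (intro sum_mono mult_mono) auto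
    finally show ?thesis by simp
  qed
  have ZT: "\<bar>(\<Sum>i<D. G r i * Z x i) - H r\<bar> \<le> T" if "x \<in> X" "r < D" for x r
    using abs_rounding_error_le[of "{..<D}" "Z x" 1 "g r" s "b r"] Z1[OF that(1)] Zb[OF that]
    unfolding G_def H_def T_def by simp
  define Q where "Q = polyQ (4 * k + 2 * n) n k
      (\<lambda>r i. of_int (relaxed_lhs n k p G r i) / 2 ^ p)
      (\<lambda>r j. of_int (relaxed_lhs n k p G r (n + j)) / 2 ^ p)
      (\<lambda>r. of_int (relaxed_rhs n k p H T r) / 2 ^ p)"
  have Q: "(x, y) \<in> Q \<longleftrightarrow> vec_in n x \<and> vec_in k y \<and>
    (\<forall>r<D. \<bar>(\<Sum>i<D. G r i * (if i < n then x i else y (i - n))) - H r\<bar> \<le> T) \<and>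
    (\<forall>j<k. 0 \<le> y j \<and> y j \<le> 1)" for x y :: "nat \<Rightarrow> real"
    unfolding Q_def D_def by (rule mem_relaxed_polyQ) simp

  have sub: "conv X \<subseteq> proj_x Q"
  proof
    fix x assume xP: "x \<in> conv X"
    then obtain S u where S: "finite S" "S \<subseteq> X" "\<forall>v\<in>S. 0 \<le> (u v :: real)" "sum u S = 1"
      "x = (\<lambda>i. \<Sum>v\<in>S. u v * v i)" unfolding conv_def by blast
    \<comment> \<open>The lifts are combined with the weights that express \<open>x\<close>; the
      relaxed constraints are convex, so they pass from the lifts to the combination.\<close>
    define y where "y = (\<lambda>j. if j < k then (\<Sum>v\<in>S. u v * Z v (n + j)) else 0)"
    define z where "z = (\<lambda>i. if i < n then x i else y (i - n))"
    have z: "z i = (\<Sum>v\<in>S. u v * Z v i)" if "i < D" for i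
    proof (cases "i < n")
      case True
      then show ?thesis unfolding z_def S(5) using Zx S(2) by (auto intro!: sum.cong)
    next
      case False
      then show ?thesis using that unfolding z_def y_def D_def by auto
    qed
    have "\<bar>(\<Sum>i<D. G r i * z i) - H r\<bar> \<le> T" if r: "r < D" for r
    proof -
      have "(\<Sum>i<D. G r i * z i) = (\<Sum>i<D. \<Sum>v\<in>S. u v * (G r i * Z v i))"
        using z by (simp add: sum_distrib_left algebra_simps)
      also have "\<dots> = (\<Sum>v\<in>S. u v * (\<Sum>i<D. G r i * Z v i))"
        by (subst sum.swap) (simp add: sum_distrib_left)
      finally have "(\<Sum>i<D. G r i * z i) - H r = (\<Sum>v\<in>S. u v * ((\<Sum>i<D. G r i * Z v i) - H r))"
        using S(4) by (simp add: right_diff_distrib sum_subtractf flip: sum_distrib_right)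
      also have "\<bar>\<dots>\<bar> \<le> (\<Sum>v\<in>S. \<bar>u v * ((\<Sum>i<D. G r i * Z v i) - H r)\<bar>)" by (rule sum_abs)
      also have "\<dots> \<le> (\<Sum>v\<in>S. u v * T)"
        unfolding abs_mult using S(2,3) ZT[OF _ r] by (intro sum_mono mult_mono) auto
      also have "\<dots> = T" using S(4) by (simp flip: sum_distrib_right)
      finally show ?thesis .
    qed
    moreover have "0 \<le> y j \<and> y j \<le> 1" if "j < k" for j
    proof
      show "0 \<le> y j" using that Zy S(2,3) unfolding y_def by (auto intro!: sum_nonneg mult_nonneg_nonneg)
      have "y j \<le> (\<Sum>v\<in>S. u v)"
        using that Zy S(2,3) unfolding y_def by (auto intro!: sum_mono mult_left_le)
      then show "y j \<le> 1" using S(4) by simp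
    qed
    moreover have "vec_in n x" "vec_in k y"
      using conv_cube01(3)[OF X(2) xP] by (auto simp: vec_in_def y_def)
    ultimately have "(x, y) \<in> Q" unfolding Q z_def by blast
    then show "x \<in> proj_x Q" unfolding proj_x_def by blast
  qed

  \<comment> \<open>For a feasible point with entries at most \<open>M\<close>, where
    \<open>1 \<le> M\<close>, the error bound will give distance \<open>\<theta> * M\<close>: the
    factor \<open>2 ^ (n + D\<^sup>2 + 1)\<close> times the residual
    \<open>2 * (D + 1) * M / s\<close>.\<close>
  define \<theta> where "\<theta> = 2 ^ (n + D\<^sup>2 + 2) * (real D + 1) / s"
  have \<theta>0: "0 \<le> \<theta>" unfolding \<theta>_def using s0 by simp
  define e :: real where "e = 1 / 2 ^ nat \<lceil>log 2 (1 / eps)\<rceil>"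
  have e: "e \<le> eps" "e \<le> 1"
    using two_power_dominates_inverse[OF eps] unfolding e_def by (auto simp: divide_le_eq)
  \<comment> \<open>The factor \<open>n\<close> pays for passing from coordinatewise to Euclidean
    distance, and 2 is the bound later found for \<open>M\<close>.\<close>
  have \<theta>e: "real n * (2 * \<theta>) \<le> e"
  proof -
    have "real n \<le> real D" unfolding D_def by simp
    also have "\<dots> \<le> 2 ^ D" using of_nat_less_two_power[of D, where ?'a = real] by simp
    finally have "real n \<le> 2 ^ D" .
    moreover have "real D + 1 \<le> 2 ^ D"
      using Suc_leI[OF less_exp[of D]] by (metis of_nat_Suc of_nat_le_iff of_nat_numeral of_nat_power add.commute)
    ultimately have nD: "real n * (real D + 1) \<le> 2 ^ D * 2 ^ D" by (intro mult_mono) auto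
    have "real n * (2 * \<theta>) = 2 ^ (n + D\<^sup>2 + 3) * (real n * (real D + 1)) / s"
      unfolding \<theta>_def by (simp add: power_add)
    also have "\<dots> \<le> 2 ^ (n + D\<^sup>2 + 3) * (2 ^ D * 2 ^ D) / s"
      using nD s0 by (intro divide_right_mono mult_left_mono) auto
    also have "\<dots> = e"
    proof -
      have "s = 2 ^ (n + D\<^sup>2 + 3) * (2 ^ D * 2 ^ D) * 2 ^ nat \<lceil>log 2 (1 / eps)\<rceil>"
        unfolding s_def p_def by (simp only: power_add mult_2 mult.assoc)
      moreover have "u / (u * v) = 1 / v" if "u \<noteq> 0" for u v :: real using that by simp
      ultimately show ?thesis unfolding e_def by (simp only:) simp
    qed
    finally show ?thesis .
  qed
  have "1 * (2 * \<theta>) \<le> real n * (2 * \<theta>)" using n \<theta>0 by (intro mult_right_mono) auto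
  then have \<theta>half: "\<theta> \<le> 1 / 2" using \<theta>e e(2) by linarith

  text \<open>The a priori bound \<open>M \<le> 1 + \<theta> * M\<close> on the entries of a feasible point is self-improving.\<close>
  have near: "\<exists>v\<in>conv X. (\<forall>i<n. \<bar>x i - v i\<bar> \<le> 2 * \<theta>)" "\<forall>i<n. \<bar>x i\<bar> \<le> 2" if "(x, y) \<in> Q" for x y
  proof -
    define z where "z = (\<lambda>i. if i < n then x i else y (i - n))"
    have Qz: "\<forall>r<D. \<bar>(\<Sum>i<D. G r i * z i) - H r\<bar> \<le> T" and y: "\<forall>j<k. 0 \<le> y j \<and> y j \<le> 1"
      using that unfolding Q z_def by auto
    \<comment> \<open>Including 1 gives \<open>1 \<le> M\<close>, so that constant terms can be
      absorbed into multiples of \<open>M\<close>.\<close>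
    define M where "M = Max (insert 1 ((\<lambda>i. \<bar>z i\<bar>) ` {..<D}))"
    have M: "1 \<le> M" "\<And>i. i < D \<Longrightarrow> \<bar>z i\<bar> \<le> M" unfolding M_def by auto
    have "\<bar>(\<Sum>i<D. g r i * z i) - b r\<bar> \<le> 2 * (real D + 1) * M / s" if r: "r < D" for r
    proof -
      have "\<bar>((\<Sum>i<D. G r i * z i) - H r) - s * ((\<Sum>i<D. g r i * z i) - b r)\<bar> \<le> D * M + 1"
        using abs_rounding_error_le[of "{..<D}" z M "g r" s "b r"] M(2) unfolding G_def H_def by simp
      then have "\<bar>s * ((\<Sum>i<D. g r i * z i) - b r)\<bar> \<le> D * M + 1 + T"
        using Qz[rule_format, OF r] by linarith
      also have "\<dots> = D * M + (D * 1 + 2)" unfolding T_def by simp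
      also have "\<dots> \<le> D * M + (D * M + 2 * M)"
        using M(1) mult_left_mono[of 1 M "real D"] of_nat_0_le_iff[of D] by linarith
      also have "\<dots> = 2 * (real D + 1) * M" by (simp add: algebra_simps)
      finally have "s * \<bar>(\<Sum>i<D. g r i * z i) - b r\<bar> \<le> 2 * (real D + 1) * M"
        using s0 by (simp add: abs_mult)
      then show ?thesis using s0 by (simp add: pos_le_divide_eq mult.commute)
    qed
    moreover have "\<forall>j<k. 0 \<le> z (n + j)" using y unfolding z_def by simp
    moreover have "0 \<le> 2 * (real D + 1) * M / s" using M(1) s0 by simp
    ultimately obtain v where v: "v \<in> conv X"
      "\<forall>i<n. \<bar>z i - v i\<bar> \<le> 2 ^ (n + D\<^sup>2 + 1) * (2 * (real D + 1) * M / s)"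
      using bound by blast
    have "2 ^ (n + D\<^sup>2 + 1) * (2 * (real D + 1) * M / s) = \<theta> * M"
      unfolding \<theta>_def by (simp add: power_add)
    then have xv: "\<bar>x i - v i\<bar> \<le> \<theta> * M" if "i < n" for i using v(2) that unfolding z_def by auto
    have x1: "\<bar>x i\<bar> \<le> 1 + \<theta> * M" if "i < n" for i
      using xv[OF that] conv_cube01(1,2)[OF X(2) v(1), of i] by linarith
    have "\<bar>z i\<bar> \<le> 1 + \<theta> * M" if "i < D" for i
    proof (cases "i < n")
      case False
      then have "\<bar>z i\<bar> \<le> 1" using y that unfolding z_def D_def by auto
      then show ?thesis using M(1) \<theta>0 by (smt (verit) mult_nonneg_nonneg)
    qed (use x1 in \<open>auto simp: z_def\<close>)
    moreover have "1 \<le> 1 + \<theta> * M" using M(1) \<theta>0 by simp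
    ultimately have "Max (insert 1 ((\<lambda>i. \<bar>z i\<bar>) ` {..<D})) \<le> 1 + \<theta> * M" by (subst Max_le_iff) auto
    then have "M \<le> 1 + \<theta> * M" unfolding M_def[symmetric] .
    also have "\<dots> \<le> 1 + 1 / 2 * M" using \<theta>half M(1) by (intro add_left_mono mult_right_mono) auto
    finally have M2: "M \<le> 2" by simp
    have \<theta>M: "\<theta> * M \<le> 2 * \<theta>" using mult_left_mono[OF M2 \<theta>0] by simp
    show "\<exists>v\<in>conv X. (\<forall>i<n. \<bar>x i - v i\<bar> \<le> 2 * \<theta>)" using v(1) xv \<theta>M by force
    show "\<forall>i<n. \<bar>x i\<bar> \<le> 2" using x1 \<theta>M \<theta>half by force
  qed
  have sup: "proj_x Q \<subseteq> thicken n (conv X) eps"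
  proof
    fix x assume "x \<in> proj_x Q"
    then obtain y where xy: "(x, y) \<in> Q" unfolding proj_x_def by blast
    obtain v where v: "v \<in> conv X" "\<forall>i<n. \<bar>x i - v i\<bar> \<le> 2 * \<theta>" using near(1)[OF xy] by blast
    have "norm2 n (\<lambda>i. x i - v i) \<le> (\<Sum>i<n. \<bar>x i - v i\<bar>)"
      using L2_set_le_sum_abs[of "\<lambda>i. x i - v i" "{..<n}"] unfolding norm2_def L2_set_def .
    also have "\<dots> \<le> (\<Sum>i<n. 2 * \<theta>)" using v(2) by (intro sum_mono) auto
    also have "\<dots> \<le> eps" using \<theta>e e(1) by simp
    finally have "norm2 n (\<lambda>i. x i - v i) \<le> eps" .
    moreover have "vec_in n (\<lambda>i. x i - v i)"
      using xy conv_cube01(3)[OF X(2) v(1)] unfolding Q by (simp add: vec_in_def)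
    ultimately show "x \<in> thicken n (conv X) eps" unfolding thicken_def
      using v(1) by (intro CollectI exI[of _ v] exI[of _ "\<lambda>i. x i - v i"]) auto
  qed
  \<comment> \<open>The coordinates \<open>y\<close> are bounded by their own inequalities, the
    coordinates \<open>x\<close> by closeness to \<open>conv X\<close>.\<close>
  have bdd: "bounded_pairs Q"
    unfolding bounded_pairs_def
  proof (intro exI[of _ 2] ballI, clarify)
    fix x y and i :: nat assume xy: "(x, y) \<in> Q"
    have "\<bar>x i\<bar> \<le> 2" using near(2)[OF xy] xy unfolding Q vec_in_def by (cases "i < n") auto
    moreover have "\<bar>y i\<bar> \<le> 2" using xy unfolding Q vec_in_def by (cases "i < k") force+
    ultimately show "\<bar>x i\<bar> \<le> 2 \<and> \<bar>y i\<bar> \<le> 2" ..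
  qed

  \<comment> \<open>The bound \<open>m * 2 ^ p\<close> is an integer, so taking the floor preserves
    it.\<close>
  have fl: "\<bar>\<lfloor>c * s\<rfloor>\<bar> \<le> m * 2 ^ p" if "\<bar>c\<bar> \<le> real_of_int m" for c and m :: int
  proof -
    have "\<bar>c * s\<bar> \<le> real_of_int (m * 2 ^ p)" using that s0 by (simp add: abs_mult s_def)
    then show ?thesis by linarith
  qed
  have DD: "2 * int D + 1 \<le> 2 ^ (D + 2)"
  proof -
    have "int D < 2 ^ D" by (rule of_nat_less_two_power)
    moreover have "(2::int) ^ (D + 2) = 4 * 2 ^ D" by (simp add: power_add)
    ultimately show ?thesis using of_nat_0_le_iff[of D, where ?'a = int] by linarith
  qed
  have le_pow: "(2::int) ^ p \<le> 2 ^ (D + p + 2)" by (intro power_increasing) auto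
  have encG: "\<bar>relaxed_lhs n k p G r i\<bar> \<le> 2 ^ (D + p + 2)" if "i < D" for r i
  proof -
    have "\<bar>G r' i\<bar> \<le> 2 ^ p" if "r' < D" for r'
      using fl[of "g r' i" 1] g1[OF that \<open>i < D\<close>] unfolding G_def by simp
    then have "\<bar>relaxed_lhs n k p G r i\<bar> \<le> 2 ^ p" unfolding relaxed_lhs_def D_def by auto
    then show ?thesis using le_pow by linarith
  qed
  have encH: "\<bar>relaxed_rhs n k p H T r\<bar> \<le> 2 ^ (D + p + 2)" for r
  proof -
    \<comment> \<open>This covers both signs with which \<open>H\<close> occurs on the right; the
      sum is at most \<open>D * 2 ^ p + (D + 1) * 2 ^ p\<close>.\<close>
    have *: "\<bar>H r'\<bar> + T \<le> 2 ^ (D + p + 2)" if "r' < D" for r'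
    proof -
      have "\<bar>H r'\<bar> \<le> int D * 2 ^ p" using fl[of "b r'" "int D"] bD[OF that] unfolding H_def by simp
      moreover have "1 * T \<le> 2 ^ p * T" unfolding T_def by (intro mult_right_mono) auto
      ultimately have "\<bar>H r'\<bar> + T \<le> (2 * int D + 1) * 2 ^ p"
        unfolding T_def by (simp add: algebra_simps)
      also have "\<dots> \<le> 2 ^ (D + 2) * 2 ^ p" using DD by (intro mult_right_mono) auto
      finally show ?thesis by (simp add: power_add ac_simps)
    qed
    have "r - (n + k) < n + k" if "r < 2 * (n + k)" "\<not> r < n + k" using that by arith
    with *[of r] *[of "r - D"] le_pow show ?thesis
      unfolding relaxed_rhs_def D_def T_def by auto
  qed
  have "enc_rat (of_int (relaxed_lhs n k p G r i) / 2 ^ p) \<le> D + 2 * p + 6" if "i < D" for r i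
    using enc_rat_dyadic_le[OF encG[OF that, of r], of p] by simp
  moreover have "enc_rat (of_int (relaxed_rhs n k p H T r) / 2 ^ p) \<le> D + 2 * p + 6" for r
    using enc_rat_dyadic_le[OF encH[of r], of p] by simp
  ultimately show ?thesis
    using bdd sub sup unfolding Q_def
    by (intro exI conjI) (assumption | simp add: D_def)+
qed

section \<open>The polynomial bound on the encoding length\<close>

lemma enc_system_le:
  assumes "\<forall>r<N. (\<forall>i<n. enc_rat (B r i) \<le> E) \<and> (\<forall>j<k. enc_rat (C r j) \<le> E) \<and> enc_rat (d r) \<le> E"
  shows "enc_system N n k B C d \<le> N * ((n + k + 1) * E)"
proof -
  have "enc_system N n k B C d \<le> (\<Sum>r<N. (\<Sum>i<n. E) + (\<Sum>j<k. E) + E)"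
    unfolding enc_system_def using assms by (intro sum_mono add_mono) auto
  then show ?thesis by (simp add: algebra_simps)
qed

lemma poly3_product:
  "poly3 (\<lambda>i j l. a i * b j * c l) D u v w = (\<Sum>i\<le>D. a i * u ^ i) * (\<Sum>j\<le>D. b j * v ^ j) * (\<Sum>l\<le>D. c l * w ^ l)"
proof -
  let ?b = "\<Sum>j\<le>D. b j * v ^ j" and ?c = "\<Sum>l\<le>D. c l * w ^ l"
  have l: "(\<Sum>l\<le>D. a i * b j * c l * u ^ i * v ^ j * w ^ l) = a i * u ^ i * ?c * (b j * v ^ j)" for i j
    by (simp add: sum_distrib_left sum_distrib_right ac_simps)
  have j: "(\<Sum>j\<le>D. a i * u ^ i * ?c * (b j * v ^ j)) = a i * u ^ i * (?b * ?c)" for i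
    by (simp only: sum_distrib_left[symmetric]) (simp add: ac_simps)
  show ?thesis unfolding poly3_def l j sum_distrib_right[symmetric] by (simp only: mult.assoc)
qed

theorem theorem6:
  "\<exists>(a::nat \<Rightarrow> nat \<Rightarrow> nat \<Rightarrow> real) (D::nat).
     \<forall>(n::nat) (X::(nat \<Rightarrow> real) set) (eps::real).
       n \<ge> 1 \<longrightarrow> X \<noteq> {} \<longrightarrow> X \<subseteq> cube01 n \<longrightarrow> eps > 0 \<longrightarrow>
       (let P = conv X; k = xc n P; nr = 4 * k + 2 * n in
        \<exists>(B::nat \<Rightarrow> nat \<Rightarrow> rat) (C::nat \<Rightarrow> nat \<Rightarrow> rat) (d::nat \<Rightarrow> rat).
          bounded_pairs (polyQ nr n k B C d) \<and>
          real (enc_system nr n k B C d) \<le> poly3 a D (real n) (real k) (log 2 (1 / eps)) \<and>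
          P \<subseteq> proj_x (polyQ nr n k B C d) \<and>
          proj_x (polyQ nr n k B C d) \<subseteq> thicken n P eps \<and>
          (\<forall>c::nat \<Rightarrow> real.
             (SUP x\<in>proj_x (polyQ nr n k B C d). dotn n c x) - (SUP x\<in>P. dotn n c x)
               \<le> eps * norm2 n c))"
proof -
  \<comment> \<open>The coefficients of
    \<open>64 * (1 + u) ^ 4 * (1 + v) ^ 4 * (1 + w\<^sup>2)\<close>. The last variable is squared
    because \<open>log 2 (1 / eps)\<close> is negative for \<open>eps > 1\<close>.\<close>
  define a :: "nat \<Rightarrow> nat \<Rightarrow> nat \<Rightarrow> real" where
    "a = (\<lambda>i j l. (64 * real (4 choose i)) * real (4 choose j) * (if l = 0 \<or> l = 2 then 1 else 0))"
  have a: "poly3 a 4 u v w = 64 * (1 + u) ^ 4 * (1 + v) ^ 4 * (1 + w\<^sup>2)" for u v w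
  proof -
    have "(\<Sum>l\<le>4::nat. (if l = 0 \<or> l = 2 then 1 else 0) * w ^ l) = 1 + w\<^sup>2"
      by (simp add: eval_nat_numeral)
    moreover have "(\<Sum>i\<le>4::nat. real (4 choose i) * u ^ i) = (1 + u) ^ 4" for u
      using binomial_ring[of u 1 4] by (simp add: add.commute)
    ultimately show ?thesis
      unfolding a_def poly3_product by (simp add: mult.assoc flip: sum_distrib_left)
  qed
  show ?thesis
  proof (intro exI[of _ a] exI[of _ "4::nat"] allI impI)
    fix n X and eps :: real
    assume n: "1 \<le> n" and X: "X \<noteq> {}" "X \<subseteq> cube01 n" and eps: "eps > 0"
    define k where "k = xc n (conv X)"
    have "X \<subseteq> Collect (vec_in n)" using X(2) unfolding cube01_def by blast
    then have ext: "ext_formulation n (conv X) k"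
      unfolding k_def xc_def
      using ext_formulation_conv[of X n] finite_subset[OF X(2) finite_cube01] by (metis LeastI_ex)
    define q where "q = nat \<lceil>log 2 (1 / eps)\<rceil>"
    define E where "E = (n + k) + 2 * (n + (n + k)\<^sup>2 + 3 + 2 * (n + k) + q) + 6"
    obtain B C d where Q: "bounded_pairs (polyQ (4 * k + 2 * n) n k B C d)"
      "\<forall>r<4 * k + 2 * n. (\<forall>i<n. enc_rat (B r i) \<le> E) \<and> (\<forall>j<k. enc_rat (C r j) \<le> E) \<and> enc_rat (d r) \<le> E"
      "conv X \<subseteq> proj_x (polyQ (4 * k + 2 * n) n k B C d)"
      "proj_x (polyQ (4 * k + 2 * n) n k B C d) \<subseteq> thicken n (conv X) eps"
      using rational_relaxation[OF n X eps ext] unfolding E_def q_def by blast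
    have "real (enc_system (4 * k + 2 * n) n k B C d) \<le> poly3 a 4 (real n) (real k) (log 2 (1 / eps))"
    proof -
      define w where "w = log 2 (1 / eps)"
      define R where "R = 1 + real n + real k"
      have R: "1 \<le> R" unfolding R_def by simp
      have "real q \<le> 1 + \<bar>w\<bar>" unfolding q_def w_def by linarith
      also have "\<bar>w\<bar> \<le> 1 + w\<^sup>2" using sum_power2_ge_zero[of "\<bar>w\<bar> - 1" 0] zero_le_power2[of w]
        by (simp add: power2_eq_square algebra_simps)
      finally have q: "real q \<le> 2 + w\<^sup>2" by simp
      define m where "m = real n + real k"
      have "real E = 5 * m + 2 * real n + 2 * m\<^sup>2 + 12 + 2 * real q"
        unfolding E_def m_def by simp
      moreover have "R\<^sup>2 = 1 + 2 * m + m\<^sup>2"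
        unfolding R_def m_def by (simp add: power2_eq_square algebra_simps)
      moreover have "0 \<le> m" "real n \<le> m" unfolding m_def by auto
      ultimately have "real E \<le> 16 * R\<^sup>2 + 2 * w\<^sup>2" using q zero_le_power2[of m] by linarith
      also have "\<dots> \<le> 16 * R\<^sup>2 + 16 * R\<^sup>2 * w\<^sup>2"
        using one_le_power[OF R, of 2] by (intro add_left_mono mult_right_mono) auto
      also have "\<dots> = 16 * R\<^sup>2 * (1 + w\<^sup>2)" by (simp add: algebra_simps)
      finally have E: "real E \<le> 16 * R\<^sup>2 * (1 + w\<^sup>2)" .
      have "enc_system (4 * k + 2 * n) n k B C d \<le> (4 * k + 2 * n) * ((n + k + 1) * E)"
        by (rule enc_system_le[OF Q(2)])
      then have "real (enc_system (4 * k + 2 * n) n k B C d) \<le> real ((4 * k + 2 * n) * ((n + k + 1) * E))"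
        by (simp only: of_nat_le_iff)
      also have "\<dots> = (4 * real k + 2 * real n) * (R * real E)" unfolding R_def by (simp add: algebra_simps)
      \<comment> \<open>\<open>4 * R\<close> bounds the number of rows and \<open>R\<close> counts
        the entries of a row, whence \<open>64 = 4 * 16\<close> and the fourth power.\<close>
      also have "\<dots> \<le> (4 * R) * (R * (16 * R\<^sup>2 * (1 + w\<^sup>2)))"
        using E R by (intro mult_mono) (auto simp: R_def)
      also have "\<dots> = 64 * R ^ 4 * (1 + w\<^sup>2)" by (simp add: eval_nat_numeral)
      \<comment> \<open>\<open>1 + n + k \<le> (1 + n) * (1 + k)\<close> separates the variables, as
        the product form of \<open>a\<close> requires.\<close>
      also have "R ^ 4 \<le> ((1 + real n) * (1 + real k)) ^ 4"
        unfolding R_def by (intro power_mono) (auto simp: algebra_simps)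
      finally show ?thesis unfolding a w_def[symmetric]
        by (simp add: power_mult_distrib mult_left_mono mult_right_mono mult.assoc)
    qed
    moreover have "(SUP x\<in>proj_x (polyQ (4 * k + 2 * n) n k B C d). dotn n c x) - (SUP x\<in>conv X. dotn n c x)
        \<le> eps * norm2 n c" for c
    proof (rule sup_le_of_thicken[where M=1])
      show "conv X \<noteq> {}" using X(1) subset_conv by blast
      show "\<bar>x i\<bar> \<le> 1" if "x \<in> conv X" for x i
        using conv_cube01(1,2)[OF X(2) that, of i] by simp
    qed (fact Q(3,4))+
    ultimately show "let P = conv X; k = xc n P; nr = 4 * k + 2 * n in
        \<exists>(B::nat \<Rightarrow> nat \<Rightarrow> rat) (C::nat \<Rightarrow> nat \<Rightarrow> rat) (d::nat \<Rightarrow> rat).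
          bounded_pairs (polyQ nr n k B C d) \<and>
          real (enc_system nr n k B C d) \<le> poly3 a 4 (real n) (real k) (log 2 (1 / eps)) \<and>
          P \<subseteq> proj_x (polyQ nr n k B C d) \<and>
          proj_x (polyQ nr n k B C d) \<subseteq> thicken n P eps \<and>
          (\<forall>c::nat \<Rightarrow> real.
             (SUP x\<in>proj_x (polyQ nr n k B C d). dotn n c x) - (SUP x\<in>P. dotn n c x)
               \<le> eps * norm2 n c)"
      unfolding Let_def k_def[symmetric] using Q by blast
  qed
qed

end
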